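(* Let $A^1$ and $A^2$ be two non-decreasing processes on $[0,\infty)$, both with initial value $0$, with $A^1$ a continuous adapted process. Let $Z$ be a non-negative adapted process with $\hat{\mathbb E}[|Z(0)|]<\infty$ of the form $$Z(t)=Z(0)+A^1(t)-A^2(t)+M(t),\qquad t\ge0,$$ where $M$ is a continuous process with initial value $0$. Assume that there exists a sequence of $\mathbb F$-stopping times $\tau_N$ with $\tau_N\to+\infty$ quasi-surely such that for every $Q\in\mathcal Q$, every $N$ and all $0\le s\le t$, $E_Q[M(t\wedge\tau_N)\mid\mathscr F_s]=M(s\wedge\tau_N)$. Then, quasi-surely, $$\{A^1(+\infty)<+\infty\}\subset\Big\{\lim_{t\to+\infty}Z(t)\text{ exists and is finite}\Big\}\cap\{A^2(+\infty)<+\infty\}\cap\Big\{\lim_{t\to+\infty}M(t)\text{ exists and is finite}\Big\},$$ where $A^i(+\infty)=\lim_{t\to+\infty}A^i(t)$ and "$\mathcal A\subset\mathcal B$ quasi-surely" means $c(\mathcal A\setminus\mathcal B)=0$.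
   Context: G-framework. Let $\mathbb S^m$ be the space of real symmetric $m\times m$ matrices and let $G:\mathbb S^m\to\mathbb R$ be sublinear ($G(A+\bar A)\le G(A)+G(\bar A)$, $G(\lambda A)=\lambda G(A)$ for $\lambda\ge0$) and monotone ($G(A)\le G(\bar A)$ if $\bar A-A$ is nonnegative definite). $\Omega$ is the space of continuous paths $[0,\infty)\to\mathbb R^m$ starting at $0$, with the topology of locally uniform convergence and Borel $\sigma$-algebra $\mathscr B(\Omega)$; $B(t)$ is the canonical process. $C_{l,\mathrm{Lip}}(\mathbb R^n)$ is the set of functions $\varphi$ with $|\varphi(x)-\varphi(y)|\le C(1+|x|^k+|y|^k)|x-y|$ for some $C,k$. $\mathrm{Lip}(\Omega)$ is the set of random variables $\varphi(B(t_1),B(t_2)-B(t_1),\dots,B(t_k)-B(t_{k-1}))$ with $\varphi\in C_{l,\mathrm{Lip}}(\mathbb R^{m\times k})$, $0\le t_1<\dots<t_k$. The $G$-expectation $\hat{\mathbb E}$ on $\mathrm{Lip}(\Omega)$ (under which $B$ is a symmetric $G$-Brownian motion) is defined as follows: $\hat{\mathbb E}[\psi(B(t)-B(s))]=u(t-s,0)$, where $u$ is the viscosity solution of $\partial_tu=G(D^2u)$, $u(0,\cdot)=\psi$; in general, setting $\varphi_k=\varphi$ and $\varphi_{j-1}(x_1,\dots,x_{j-1})=\hat{\mathbb E}[\varphi_j(x_1,\dots,x_{j-1},B(t_j)-B(t_{j-1}))]$ (with $t_0=0$), one puts $\hat{\mathbb E}[\varphi(B(t_1),\dots,B(t_k)-B(t_{k-1}))]=\varphi_0$.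 $\mathcal Q$ is the set of probability measures $Q$ on $(\Omega,\mathscr B(\Omega))$ with $E_Q[X]\le\hat{\mathbb E}[X]$ for all $X\in\mathrm{Lip}(\Omega)$ (equivalently, for all $X$ in the completion $L^1_G(\Omega)$ of $\mathrm{Lip}(\Omega)$ under $\hat{\mathbb E}[|\cdot|]$). One has $\hat{\mathbb E}[X]=\sup_{Q\in\mathcal Q}E_Q[X]$, and this formula extends $\hat{\mathbb E}$ to all measurable $X$ for which $E_Q[X]$ exists for every $Q\in\mathcal Q$. The capacity is $c(\mathcal A)=\sup_{Q\in\mathcal Q}Q(\mathcal A)$; a property holds quasi-surely (q.s.) if it holds outside a set $\mathcal A$ with $c(\mathcal A)=0$. $\mathscr F_t$ is the completion of $\sigma(B(s):s\le t)$ by the sets of capacity zero, $\mathbb F=(\mathscr F_t)_{t\ge0}$; adaptedness is with respect to $\mathbb F$; an $\mathbb F$-stopping time is a random time $\tau$ with $\{\tau\le t\}\in\mathscr F_t$ for every $t\ge0$. *)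

theory Defs
  imports "HOL-Probability.Probability"
begin

section \<open>The generator\<close>

definition sym_matrices :: "(real^'m^'m) set" where
  "sym_matrices = {A. transpose A = A}"

definition nonneg_definite :: "real^'m^'m \<Rightarrow> bool" where
  "nonneg_definite A \<longleftrightarrow> (\<forall>x. 0 \<le> x \<bullet> (A *v x))"

definition sublinear_on_sym :: "(real^'m^'m \<Rightarrow> real) \<Rightarrow> bool" where
  "sublinear_on_sym G \<longleftrightarrow>
     (\<forall>A\<in>sym_matrices. \<forall>A'\<in>sym_matrices. G (A + A') \<le> G A + G A') \<and>
     (\<forall>A\<in>sym_matrices. \<forall>r\<ge>0. G (r *\<^sub>R A) = r * G A)"

definition monotone_on_sym :: "(real^'m^'m \<Rightarrow> real) \<Rightarrow> bool" where
  "monotone_on_sym G \<longleftrightarrow>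
     (\<forall>A\<in>sym_matrices. \<forall>A'\<in>sym_matrices. nonneg_definite (A' - A) \<longrightarrow> G A \<le> G A')"


section \<open>Path space\<close>

type_synonym 'm path = "real \<Rightarrow> real^'m"

text \<open>Functions on \<open>[0,\<infinity>)\<close> are functions on the reals; extensionality makes a path
  determined by its restriction to \<open>[0,\<infinity>)\<close>.\<close>

definition path_space :: "'m::finite path set" where
  "path_space = {\<omega> \<in> extensional {0..}. continuous_on {0..} \<omega> \<and> \<omega> 0 = 0}"

definition path_open :: "'m::finite path set \<Rightarrow> bool" where
  "path_open U \<longleftrightarrow> U \<subseteq> path_space \<and>
     (\<forall>\<omega>\<in>U. \<exists>T. \<exists>\<epsilon>>0. {\<omega>' \<in> path_space. \<forall>t\<in>{0..T}. dist (\<omega>' t) (\<omega> t) < \<epsilon>} \<subseteq> U)"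

definition path_topology :: "'m::finite path topology" where
  "path_topology = topology path_open"

lemma istopology_path_open: "istopology path_open"
  unfolding istopology_def
proof (intro conjI allI impI)
  fix U V :: "'m::finite path set"
  assume U: "path_open U" and V: "path_open V"
  show "path_open (U \<inter> V)"
    unfolding path_open_def
  proof (intro conjI ballI)
    show "U \<inter> V \<subseteq> path_space"
      using U by (auto simp: path_open_def)
    fix \<omega> assume \<omega>: "\<omega> \<in> U \<inter> V"
    obtain T \<epsilon> where 1: "\<epsilon> > 0"
      "{\<omega>' \<in> path_space. \<forall>t\<in>{0..T}. dist (\<omega>' t) (\<omega> t) < \<epsilon>} \<subseteq> U"
      using U \<omega> unfolding path_open_def by blast
    obtain S \<delta> where 2: "\<delta> > 0"
      "{\<omega>' \<in> path_space. \<forall>t\<in>{0..S}. dist (\<omega>' t) (\<omega> t) < \<delta>} \<subseteq> V"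
      using V \<omega> unfolding path_open_def by blast
    have "{\<omega>' \<in> path_space. \<forall>t\<in>{0..max T S}. dist (\<omega>' t) (\<omega> t) < min \<epsilon> \<delta>} \<subseteq> U \<inter> V"
      using 1(2) 2(2) by (auto 0 3 simp: subset_iff)
    then show "\<exists>T. \<exists>\<epsilon>>0. {\<omega>' \<in> path_space. \<forall>t\<in>{0..T}. dist (\<omega>' t) (\<omega> t) < \<epsilon>} \<subseteq> U \<inter> V"
      using 1(1) 2(1) by (intro exI[of _ "max T S"] exI[of _ "min \<epsilon> \<delta>"]) simp
  qed
next
  fix \<K> :: "'m::finite path set set"
  assume "\<forall>K\<in>\<K>. path_open K"
  then show "path_open (\<Union>\<K>)"
    unfolding path_open_def by (meson Sup_le_iff Sup_upper UnionE order_trans)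
qed

lemma openin_path_topology: "openin path_topology U \<longleftrightarrow> path_open U"
  by (simp add: path_topology_def topology_inverse'[OF istopology_path_open])

definition path_borel :: "'m::finite path measure" where
  "path_borel = sigma path_space {U. openin path_topology U}"

definition canonical :: "real \<Rightarrow> 'm::finite path \<Rightarrow> real^'m" where
  "canonical t \<omega> = \<omega> t"


section \<open>The G-heat equation\<close>

text \<open>\<open>\<phi>\<close> is of class \<open>C\<^sup>1\<^sup>,\<^sup>2\<close> on \<open>(0,\<infinity>) \<times> \<real>\<^sup>m\<close>, with time derivative \<open>p\<close>, spatial
  gradient \<open>g\<close> and spatial Hessian \<open>H\<close>.\<close>

definition C12_with ::
  "(real \<Rightarrow> real^'m \<Rightarrow> real) \<Rightarrow> (real \<Rightarrow> real^'m \<Rightarrow> real) \<Rightarrow>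
   (real \<Rightarrow> real^'m \<Rightarrow> real^'m) \<Rightarrow> (real \<Rightarrow> real^'m \<Rightarrow> real^'m^'m) \<Rightarrow> bool" where
  "C12_with \<phi> p g H \<longleftrightarrow>
     (\<forall>t>0. \<forall>x. ((\<lambda>s. \<phi> s x) has_real_derivative p t x) (at t) \<and>
                (\<phi> t has_derivative (\<lambda>h. g t x \<bullet> h)) (at x) \<and>
                (g t has_derivative (\<lambda>h. H t x *v h)) (at x)) \<and>
     continuous_on ({0<..} \<times> UNIV) (\<lambda>(t, x). \<phi> t x) \<and>
     continuous_on ({0<..} \<times> UNIV) (\<lambda>(t, x). p t x) \<and>
     continuous_on ({0<..} \<times> UNIV) (\<lambda>(t, x). g t x) \<and>
     continuous_on ({0<..} \<times> UNIV) (\<lambda>(t, x). H t x)"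

definition viscosity_subsolution ::
  "(real^'m^'m \<Rightarrow> real) \<Rightarrow> (real \<Rightarrow> real^'m \<Rightarrow> real) \<Rightarrow> bool" where
  "viscosity_subsolution G u \<longleftrightarrow>
     (\<forall>\<phi> p g H. C12_with \<phi> p g H \<longrightarrow>
        (\<forall>t>0. \<forall>x. \<phi> t x = u t x \<and> (\<forall>s>0. \<forall>y. u s y \<le> \<phi> s y) \<longrightarrow> p t x \<le> G (H t x)))"

definition viscosity_supersolution ::
  "(real^'m^'m \<Rightarrow> real) \<Rightarrow> (real \<Rightarrow> real^'m \<Rightarrow> real) \<Rightarrow> bool" where
  "viscosity_supersolution G u \<longleftrightarrow>
     (\<forall>\<phi> p g H. C12_with \<phi> p g H \<longrightarrow>
        (\<forall>t>0. \<forall>x. \<phi> t x = u t x \<and> (\<forall>s>0. \<forall>y. \<phi> s y \<le> u s y) \<longrightarrow> G (H t x) \<le> p t x))"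

text \<open>Polynomial growth, locally uniformly in time, is the class in which the viscosity
  solution is unique (already for the classical heat equation uniqueness fails without a
  growth condition).\<close>

definition G_heat_solution ::
  "(real^'m^'m \<Rightarrow> real) \<Rightarrow> (real^'m \<Rightarrow> real) \<Rightarrow> (real \<Rightarrow> real^'m \<Rightarrow> real) \<Rightarrow> bool" where
  "G_heat_solution G \<psi> u \<longleftrightarrow>
     continuous_on ({0..} \<times> UNIV) (\<lambda>(t, x). u t x) \<and>
     (\<forall>T\<ge>0. \<exists>C. \<exists>k::nat. \<forall>t\<in>{0..T}. \<forall>x. \<bar>u t x\<bar> \<le> C * (1 + norm x ^ k)) \<and>
     viscosity_subsolution G u \<and> viscosity_supersolution G u \<and>
     (\<forall>x. u 0 x = \<psi> x)"

text \<open>\<open>G_heat G d \<psi>\<close> is \<open>u(d, 0)\<close>. The description is of the value, not of \<open>u\<close>, because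
  \<open>u\<close> is arbitrary at negative times.\<close>

definition G_heat :: "(real^'m^'m \<Rightarrow> real) \<Rightarrow> real \<Rightarrow> (real^'m \<Rightarrow> real) \<Rightarrow> real" where
  "G_heat G d \<psi> = (THE v. \<exists>u. G_heat_solution G \<psi> u \<and> v = u d 0)"


section \<open>G-expectation of cylinder random variables\<close>

text \<open>Elements of \<open>\<real>\<^sup>m\<^sup>\<times>\<^sup>k\<close> are lists of length \<open>k\<close> of vectors in \<open>\<real>\<^sup>m\<close>.\<close>

definition tuple_norm :: "(real^'m) list \<Rightarrow> real" where
  "tuple_norm xs = sqrt (\<Sum>x\<leftarrow>xs. (norm x)\<^sup>2)"

definition C_l_Lip :: "nat \<Rightarrow> ((real^'m) list \<Rightarrow> real) set" where
  "C_l_Lip k = {\<phi>. \<exists>C. \<exists>r::nat. \<forall>xs ys. length xs = k \<longrightarrow> length ys = k \<longrightarrow>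
     \<bar>\<phi> xs - \<phi> ys\<bar> \<le> C * (1 + tuple_norm xs ^ r + tuple_norm ys ^ r) * tuple_norm (map2 (-) xs ys)}"

text \<open>For \<open>ts = [t\<^sub>1, \<dots>, t\<^sub>k]\<close> the list \<open>zip ts (0 # ts)\<close> is
  \<open>[(t\<^sub>1, 0), (t\<^sub>2, t\<^sub>1), \<dots>, (t\<^sub>k, t\<^sub>k\<^sub>-\<^sub>1)]\<close>; recall \<open>canonical 0 = 0\<close> on \<open>path_space\<close>.\<close>

definition admissible_times :: "real list \<Rightarrow> bool" where
  "admissible_times ts \<longleftrightarrow> ts \<noteq> [] \<and> sorted_wrt (<) ts \<and> (\<forall>t\<in>set ts. 0 \<le> t)"

definition cylinder :: "real list \<Rightarrow> ((real^'m) list \<Rightarrow> real) \<Rightarrow> 'm::finite path \<Rightarrow> real" where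
  "cylinder ts \<phi> \<omega> = \<phi> (map2 (\<lambda>t s. canonical t \<omega> - canonical s \<omega>) ts (0 # ts))"

text \<open>If \<open>ds\<close> lists the time steps \<open>t\<^sub>i - t\<^sub>i\<^sub>-\<^sub>1\<close> for \<open>i > j\<close> and \<open>xs\<close> has length \<open>j\<close>,
  then \<open>backward G \<phi> ds xs\<close> is \<open>\<phi>\<^sub>j(xs)\<close>.\<close>

fun backward ::
  "(real^'m^'m \<Rightarrow> real) \<Rightarrow> ((real^'m) list \<Rightarrow> real) \<Rightarrow> real list \<Rightarrow> (real^'m) list \<Rightarrow> real" where
  "backward G \<phi> [] xs = \<phi> xs"
| "backward G \<phi> (d # ds) xs = G_heat G d (\<lambda>y. backward G \<phi> ds (xs @ [y]))"

text \<open>The G-expectation of \<open>cylinder ts \<phi>\<close>.\<close>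

definition G_expectation_cyl ::
  "(real^'m^'m \<Rightarrow> real) \<Rightarrow> real list \<Rightarrow> ((real^'m) list \<Rightarrow> real) \<Rightarrow> real" where
  "G_expectation_cyl G ts \<phi> = backward G \<phi> (map2 (-) ts (0 # ts)) []"


section \<open>Representing measures, capacity and filtration\<close>

text \<open>Integrability is explicit because the Bochner integral of a non-integrable function
  is \<open>0\<close> by convention.\<close>

definition rep_measures :: "(real^'m^'m \<Rightarrow> real) \<Rightarrow> 'm::finite path measure set" where
  "rep_measures G = {Q. prob_space Q \<and> space Q = path_space \<and> sets Q = sets path_borel \<and>
     (\<forall>ts \<phi>. admissible_times ts \<longrightarrow> \<phi> \<in> C_l_Lip (length ts) \<longrightarrow>
        integrable Q (cylinder ts \<phi>) \<and>
        integral\<^sup>L Q (cylinder ts \<phi>) \<le> G_expectation_cyl G ts \<phi>)}"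

text \<open>The G-expectation of a non-negative random variable. The measures are completed so that
  random variables measurable only up to polar sets are covered.\<close>

definition G_expectation_nn ::
  "(real^'m^'m \<Rightarrow> real) \<Rightarrow> ('m::finite path \<Rightarrow> ennreal) \<Rightarrow> ennreal" where
  "G_expectation_nn G X = (SUP Q\<in>rep_measures G. \<integral>\<^sup>+\<omega>. X \<omega> \<partial>completion Q)"

text \<open>The outer measure agrees with \<open>Q\<close> on Borel sets; on an arbitrary set \<open>emeasure\<close> would be
  \<open>0\<close> by convention.\<close>

definition capacity :: "(real^'m^'m \<Rightarrow> real) \<Rightarrow> 'm::finite path set \<Rightarrow> ennreal" where
  "capacity G A = (SUP Q\<in>rep_measures G. outer_measure_of Q A)"

definition polar_sets :: "(real^'m^'m \<Rightarrow> real) \<Rightarrow> 'm::finite path set set" where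
  "polar_sets G = {N. N \<subseteq> path_space \<and> capacity G N = 0}"

definition quasi_surely ::
  "(real^'m^'m \<Rightarrow> real) \<Rightarrow> ('m::finite path \<Rightarrow> bool) \<Rightarrow> bool" where
  "quasi_surely G P \<longleftrightarrow> (\<exists>N\<in>polar_sets G. \<forall>\<omega>\<in>path_space - N. P \<omega>)"

definition polar_completion ::
  "(real^'m^'m \<Rightarrow> real) \<Rightarrow> 'm::finite path set set \<Rightarrow> 'm path measure" where
  "polar_completion G \<A> = sigma path_space (\<A> \<union> polar_sets G)"

definition \<F> :: "(real^'m^'m \<Rightarrow> real) \<Rightarrow> real \<Rightarrow> 'm::finite path measure" where
  "\<F> G t = polar_completion G {canonical s -` S \<inter> path_space | s S. s \<in> {0..t} \<and> S \<in> sets borel}"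

text \<open>Processes have real values; only times \<open>t \<ge> 0\<close> matter.\<close>

definition is_process :: "(real^'m^'m \<Rightarrow> real) \<Rightarrow> (real \<Rightarrow> 'm::finite path \<Rightarrow> real) \<Rightarrow> bool" where
  "is_process G X \<longleftrightarrow> (\<forall>t\<ge>0. X t \<in> borel_measurable (polar_completion G (sets path_borel)))"

definition adapted :: "(real^'m^'m \<Rightarrow> real) \<Rightarrow> (real \<Rightarrow> 'm::finite path \<Rightarrow> real) \<Rightarrow> bool" where
  "adapted G X \<longleftrightarrow> (\<forall>t\<ge>0. X t \<in> borel_measurable (\<F> G t))"

definition is_stopping_time :: "(real^'m^'m \<Rightarrow> real) \<Rightarrow> ('m::finite path \<Rightarrow> ennreal) \<Rightarrow> bool" where
  "is_stopping_time G \<tau> \<longleftrightarrow> (\<forall>t\<ge>0. {\<omega> \<in> path_space. \<tau> \<omega> \<le> ennreal t} \<in> sets (\<F> G t))"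

definition stopped ::
  "(real \<Rightarrow> 'm::finite path \<Rightarrow> real) \<Rightarrow> ('m path \<Rightarrow> ennreal) \<Rightarrow> real \<Rightarrow> 'm path \<Rightarrow> real" where
  "stopped X \<tau> t \<omega> = X (enn2real (min (ennreal t) (\<tau> \<omega>))) \<omega>"

definition nondecreasing_from_0 :: "(real \<Rightarrow> real) \<Rightarrow> bool" where
  "nondecreasing_from_0 f \<longleftrightarrow> f 0 = 0 \<and> mono_on {0..} f"

definition at_infinity_value :: "(real \<Rightarrow> 'm::finite path \<Rightarrow> real) \<Rightarrow> 'm path \<Rightarrow> ereal" where
  "at_infinity_value X \<omega> = Lim at_top (\<lambda>t. ereal (X t \<omega>))"

definition has_finite_limit :: "(real \<Rightarrow> 'm::finite path \<Rightarrow> real) \<Rightarrow> 'm path \<Rightarrow> bool" where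
  "has_finite_limit X \<omega> \<longleftrightarrow> (\<exists>l::real. ((\<lambda>t. X t \<omega>) \<longlongrightarrow> l) at_top)"

text \<open>\<open>real_cond_exp (completion Q) (\<F> G t)\<close> is a genuine conditional expectation.\<close>

lemma path_open_cylinder:
  assumes "0 \<le> s" and "open S"
  shows "path_open (canonical s -` S \<inter> path_space :: 'm::finite path set)"
  unfolding path_open_def
proof (intro conjI ballI)
  show "canonical s -` S \<inter> path_space \<subseteq> (path_space :: 'm path set)" by simp
  fix \<omega> :: "'m path" assume \<omega>: "\<omega> \<in> canonical s -` S \<inter> path_space"
  then have "\<omega> s \<in> S" by (simp add: canonical_def)
  then obtain \<epsilon> where "\<epsilon> > 0" and e: "\<forall>y. dist y (\<omega> s) < \<epsilon> \<longrightarrow> y \<in> S"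
    using \<open>open S\<close> by (auto simp: open_dist)
  have "{\<omega>' \<in> path_space. \<forall>t\<in>{0..s}. dist (\<omega>' t) (\<omega> t) < \<epsilon>} \<subseteq> canonical s -` S \<inter> path_space"
    using e \<open>0 \<le> s\<close> by (auto simp: canonical_def)
  then show "\<exists>T. \<exists>\<epsilon>>0. {\<omega>' \<in> path_space. \<forall>t\<in>{0..T}. dist (\<omega>' t) (\<omega> t) < \<epsilon>}
      \<subseteq> canonical s -` S \<inter> path_space"
    using \<open>\<epsilon> > 0\<close> by blast
qed

lemma canonical_borel_measurable:
  assumes "0 \<le> s"
  shows "(canonical s :: 'm::finite path \<Rightarrow> real^'m) \<in> borel_measurable path_borel"
proof (rule borel_measurableI)
  fix S :: "(real^'m) set" assume "open S"
  have sub: "{U. openin path_topology U} \<subseteq> Pow (path_space :: 'm path set)"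
    by (auto simp: openin_path_topology path_open_def)
  have "canonical s -` S \<inter> path_space \<in> {U :: 'm path set. openin path_topology U}"
    using path_open_cylinder[OF assms \<open>open S\<close>] by (simp add: openin_path_topology)
  then show "canonical s -` S \<inter> space path_borel \<in> sets (path_borel :: 'm path measure)"
    using sub by (simp add: path_borel_def)
qed

lemma polar_set_completion:
  assumes "Q \<in> rep_measures G" and "N \<in> polar_sets G"
  shows "N \<in> sets (completion Q)"
proof -
  have "outer_measure_of Q N \<le> capacity G N"
    unfolding capacity_def using assms(1) by (rule SUP_upper)
  then have 0: "outer_measure_of Q N = 0"
    using assms(2) by (simp add: polar_sets_def)
  have "N \<subseteq> space Q"
    using assms by (simp add: polar_sets_def rep_measures_def)
  then obtain E where "E \<in> sets Q" "N \<subseteq> E" "emeasure Q E = 0"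
    using outer_measure_of_attain[of N Q] 0 by auto
  then have "N \<in> null_sets (completion Q)"
    by (meson null_sets_completion_subset null_sets_completionI null_setsI)
  then show ?thesis by auto
qed

lemma subalgebra_\<F>:
  fixes G :: "real^'m^'m \<Rightarrow> real" and Q :: "'m::finite path measure"
  assumes Q: "Q \<in> rep_measures G"
  shows "subalgebra (completion Q) (\<F> G t)"
proof -
  have sp: "space Q = path_space" and st: "sets Q = sets path_borel"
    using Q by (auto simp: rep_measures_def)
  have spb: "space (path_borel :: 'm path measure) = path_space"
    by (auto simp: path_borel_def openin_path_topology path_open_def intro!: space_measure_of)
  let ?C = "{canonical s -` S \<inter> path_space | s S. s \<in> {0..t} \<and> S \<in> sets borel}
    :: 'm path set set"
  have C: "?C \<subseteq> sets Q"
  proof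
    fix X assume "X \<in> ?C"
    then obtain s S where "X = canonical s -` S \<inter> path_space" "0 \<le> s" "S \<in> sets borel"
      by auto
    then show "X \<in> sets Q"
      using measurable_sets[OF canonical_borel_measurable, of s S] by (simp add: st spb)
  qed
  have D: "?C \<union> polar_sets G \<subseteq> sets (completion Q)"
    using C polar_set_completion[OF Q] by auto
  have E: "?C \<union> polar_sets G \<subseteq> Pow path_space"
    by (auto simp: polar_sets_def)
  show ?thesis
    unfolding subalgebra_def \<F>_def polar_completion_def
  proof
    show "space (sigma path_space (?C \<union> polar_sets G)) = space (completion Q)"
      using space_measure_of[OF E] sp by simp
    show "sets (sigma path_space (?C \<union> polar_sets G)) \<subseteq> sets (completion Q)"
      using sets.sigma_sets_subset[OF D] sets_measure_of[OF E] sp by simp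
  qed
qed

end

(*
  Fix Q in the set of representing measures. Since Z + A2 is non-negative, M is bounded below by -Z(0) - A1, hence by the
  Q-integrable variable -Z(0) - k up to the time at which A1 reaches the level k. So, up to that
  time, M is a local martingale with an integrable lower bound, and Doob's upcrossing inequality
  shows that it converges Q-almost surely on the event that A1 stays below k. Then A2 is bounded
  by Z(0) + A1 + M, and A2 and Z converge too.

  No optional stopping in continuous time is needed. On the grid of mesh 2^-n, M is stopped at the
  first grid point at which A1 lies in [k, k+1]. A path of A1 may jump over this window between two
  grid points; then M is not stopped before the horizon T. The resulting error
  E[|M(T)|; window missed] tends to 0 as n grows, because A1 is continuous.
*)

theory Submission
  imports Defs
begin

section \<open>Upcrossings of real sequences\<close>

text \<open>The strategy buys at a value of at most \<open>a\<close> and sells at a value of at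
  least \<open>b\<close>. \<open>holding\<close> is its state after the given index, and
  \<open>upcrossings\<close> counts its completed sales.\<close>

fun holding :: "real \<Rightarrow> real \<Rightarrow> (nat \<Rightarrow> real) \<Rightarrow> nat \<Rightarrow> bool" where
  "holding a b x 0 = (x 0 \<le> a)"
| "holding a b x (Suc n) = (if holding a b x n then x (Suc n) < b else x (Suc n) \<le> a)"

fun upcrossings :: "real \<Rightarrow> real \<Rightarrow> (nat \<Rightarrow> real) \<Rightarrow> nat \<Rightarrow> nat" where
  "upcrossings a b x 0 = 0"
| "upcrossings a b x (Suc n) = upcrossings a b x n + of_bool (holding a b x n \<and> b \<le> x (Suc n))"

text \<open>The gain of the strategy that holds one unit while waiting for an upcrossing to complete,
  less the unrealised gain of the open position.\<close>

lemma upcrossings_gain_holding: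
  assumes "a < b"
  shows "(b - a) * real (upcrossings a b x n)
    \<le> (\<Sum>i<n. of_bool (holding a b x i) * (x (Suc i) - x i))
        - of_bool (holding a b x n) * (x n - a)"
proof (induction n)
  case 0
  then show ?case by simp
next
  case (Suc n)
  \<comment> \<open>During a holding period the right-hand side stays constant. A sale adds
    \<open>x (Suc n) - a\<close>, which is at least \<open>b - a\<close>, and a purchase adds
    \<open>a - x (Suc n)\<close>, which is non-negative.\<close>
  then show ?case
    using assms by (auto simp: algebra_simps split: if_splits)
qed

text \<open>A position still open at the end hurts only if the last value lies below
  \<open>a\<close>, and then by exactly that shortfall.\<close>

lemma upcrossings_gain:
  assumes "a < b"
  shows "(b - a) * real (upcrossings a b x n)
    \<le> (\<Sum>i<n. of_bool (holding a b x i) * (x (Suc i) - x i)) + max 0 (a - x n)"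
proof -
  have "- of_bool (holding a b x n) * (x n - a) \<le> max 0 (a - x n)"
    by (cases "holding a b x n") auto
  then show ?thesis
    using upcrossings_gain_holding[OF assms, of x n] by linarith
qed

lemma upcrossings_cong:
  assumes "\<And>i. i \<le> n \<Longrightarrow> x i = y i"
  shows "upcrossings a b x n = upcrossings a b y n"
proof -
  have "holding a b x n = holding a b y n \<and> upcrossings a b x n = upcrossings a b y n"
    using assms by (induction n) auto
  then show ?thesis ..
qed

lemma upcrossings_le: "upcrossings a b x n \<le> n"
  by (induction n) (auto simp: of_bool_def)

lemma upcrossings_mono:
  assumes "m \<le> n"
  shows "upcrossings a b x m \<le> upcrossings a b x n"
  using assms by (induction rule: dec_induct) auto

text \<open>The strategy holds at \<open>m\<close>, whatever its earlier state, and no longer holds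
  at \<open>p\<close>. A position is closed only by a sale, and every sale is counted.\<close>

lemma upcrossings_crossing:
  assumes "a < b" "m < p" "x m \<le> a" "b \<le> x p"
  shows "upcrossings a b x m < upcrossings a b x p"
proof -
  have m: "holding a b x m"
    using assms by (cases m) auto
  have "upcrossings a b x m < upcrossings a b x q \<or> holding a b x q" if "m \<le> q" for q
    using that by (induction rule: dec_induct) (use m in \<open>auto intro!: le_imp_less_Suc upcrossings_mono\<close>)
  moreover have "\<not> holding a b x p"
    using assms by (cases p) auto
  ultimately show ?thesis
    using assms(2) by (meson less_imp_le)
qed

text \<open>The sequence \<open>y\<close> stopped at the first index at which \<open>S\<close> holds, written as a sum of
  increments so that it is visibly a martingale transform.\<close>

definition stopped_seq :: "(nat \<Rightarrow> bool) \<Rightarrow> (nat \<Rightarrow> real) \<Rightarrow> nat \<Rightarrow> real" where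
  "stopped_seq S y n = y 0 + (\<Sum>i<n. of_bool (\<forall>j\<le>i. \<not> S j) * (y (Suc i) - y i))"

lemma stopped_seq_not_stopped:
  assumes "\<And>i. i < n \<Longrightarrow> \<not> S i"
  shows "stopped_seq S y n = y n"
proof -
  have "stopped_seq S y n = y 0 + (\<Sum>i<n. y (Suc i) - y i)"
    unfolding stopped_seq_def using assms by (auto intro!: sum.cong)
  then show ?thesis
    by (simp add: sum_lessThan_telescope)
qed

lemma stopped_seq_value:
  obtains m where "m \<le> n" "stopped_seq S y n = y m" "S m \<or> m = n \<and> (\<forall>j<n. \<not> S j)"
proof -
  have "\<exists>m\<le>n. stopped_seq S y n = y m \<and> (S m \<or> m = n \<and> (\<forall>j<n. \<not> S j))"
  proof (induction n)
    case 0
    then show ?case by (simp add: stopped_seq_def)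
  next
    case (Suc n)
    show ?case
    proof (cases "\<forall>j\<le>n. \<not> S j")
      case True
      then show ?thesis
        using stopped_seq_not_stopped[of "Suc n" S y] by (auto simp: less_Suc_eq_le)
    next
      case False
      then have "stopped_seq S y (Suc n) = stopped_seq S y n"
        by (auto simp: stopped_seq_def)
      moreover obtain m where "m \<le> n" "stopped_seq S y n = y m" "S m \<or> m = n \<and> (\<forall>j<n. \<not> S j)"
        using Suc by auto
      \<comment> \<open>Some index up to \<open>n\<close> stops. If none before \<open>n\<close>
        does, then \<open>n\<close> itself stops, so \<open>S m\<close> holds in either
        alternative.\<close>
      ultimately show ?thesis
        using False by (intro exI[of _ m]) (auto simp: le_less)
    qed
  qed
  then show ?thesis using that by blast
qed

section \<open>The upcrossing inequality\<close>

lemma measurable_real_of_bool: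
  assumes "Measurable.pred M P"
  shows "(\<lambda>x. of_bool (P x) :: real) \<in> borel_measurable M"
proof -
  note assms [measurable]
  have "(\<lambda>x. if P x then 1 else 0 :: real) \<in> borel_measurable M"
    by measurable
  then show ?thesis
    by (simp add: of_bool_def)
qed

lemma upcrossings_measurable:
  assumes "\<And>i. i \<le> n \<Longrightarrow> X i \<in> borel_measurable M"
  shows "Measurable.pred M (\<lambda>\<omega>. holding a b (\<lambda>j. X j \<omega>) n)"
    and "(\<lambda>\<omega>. upcrossings a b (\<lambda>j. X j \<omega>) n) \<in> measurable M (count_space UNIV)"
proof -
  have "Measurable.pred M (\<lambda>\<omega>. holding a b (\<lambda>j. X j \<omega>) n)
    \<and> (\<lambda>\<omega>. upcrossings a b (\<lambda>j. X j \<omega>) n) \<in> measurable M (count_space UNIV)"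
    using assms
  proof (induction n)
    case 0
    have [measurable]: "X 0 \<in> borel_measurable M" using 0 by simp
    show ?case by simp
  next
    case (Suc i)
    have [measurable]: "X (Suc i) \<in> borel_measurable M" using Suc.prems by simp
    have [measurable]: "Measurable.pred M (\<lambda>\<omega>. holding a b (\<lambda>j. X j \<omega>) i)"
      "(\<lambda>\<omega>. upcrossings a b (\<lambda>j. X j \<omega>) i) \<in> measurable M (count_space UNIV)"
      using Suc by auto
    show ?case by simp
  qed
  then show "Measurable.pred M (\<lambda>\<omega>. holding a b (\<lambda>j. X j \<omega>) n)"
    and "(\<lambda>\<omega>. upcrossings a b (\<lambda>j. X j \<omega>) n) \<in> measurable M (count_space UNIV)"
    by auto
qed

section \<open>Martingales closed by a terminal variable and stopped in discrete time\<close>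

locale closed_martingale = prob_space +
  fixes F :: "nat \<Rightarrow> 'a measure" and \<xi> :: "'a \<Rightarrow> real"
  assumes subalg: "\<And>i. subalgebra M (F i)"
    and filtration: "\<And>i j. i \<le> j \<Longrightarrow> subalgebra (F j) (F i)"
    and integrable_\<xi> [simp]: "integrable M \<xi>"
begin

text \<open>The process to which this is applied is not assumed adapted. The conditional
  expectations \<open>Y i\<close> are measurable for \<open>F i\<close> by construction and will
  agree with it almost everywhere.\<close>

definition Y :: "nat \<Rightarrow> 'a \<Rightarrow> real" where
  "Y i = real_cond_exp M (F i) \<xi>"

lemma sf: "sigma_finite_subalgebra M (F i)"
proof -
  interpret finite_measure_subalgebra M "F i"
    using subalg[of i] by unfold_locales
  show ?thesis by unfold_locales
qed

lemma measurable_filtration: "f \<in> measurable (F i) N \<Longrightarrow> i \<le> j \<Longrightarrow> f \<in> measurable (F j) N"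
  using measurable_from_subalg[OF filtration] .

lemma Y_measurable [measurable]: "Y i \<in> borel_measurable (F i)"
  by (simp add: Y_def)

lemma Y_integrable: "integrable M (Y i)"
  unfolding Y_def by (intro sigma_finite_subalgebra.real_cond_exp_int(1)[OF sf]) simp

lemma integrable_bounded_mult:
  assumes "H \<in> borel_measurable M" "\<And>\<omega>. \<bar>H \<omega>\<bar> \<le> (1::real)" "integrable M f"
  shows "integrable M (\<lambda>\<omega>. H \<omega> * f \<omega>)"
proof (rule Bochner_Integration.integrable_bound[OF assms(3)])
  show "AE \<omega> in M. norm (H \<omega> * f \<omega>) \<le> norm (f \<omega>)"
    using assms(2) by (auto simp: abs_mult mult_left_le_one_le)
qed (use assms in auto)

text \<open>For \<open>j = i\<close> and \<open>j = Suc i\<close>, \<open>H\<close> is measurable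
  for \<open>F j\<close>, so integrating \<open>H\<close> against \<open>Y j\<close> gives the same
  value as integrating it against \<open>\<xi>\<close>.\<close>

lemma Y_increment:
  assumes H: "H \<in> borel_measurable (F i)" "\<And>\<omega>. \<bar>H \<omega>\<bar> \<le> 1"
  shows "integrable M (\<lambda>\<omega>. H \<omega> * (Y (Suc i) \<omega> - Y i \<omega>))"
    and "(\<integral>\<omega>. H \<omega> * (Y (Suc i) \<omega> - Y i \<omega>) \<partial>M) = 0"
proof -
  have HM: "H \<in> borel_measurable M"
    using measurable_from_subalg[OF subalg H(1)] .
  note int = integrable_bounded_mult[OF HM H(2)]
  have eq: "(\<integral>\<omega>. H \<omega> * Y j \<omega> \<partial>M) = (\<integral>\<omega>. H \<omega> * \<xi> \<omega> \<partial>M)" if "i \<le> j" for j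
    unfolding Y_def using measurable_filtration[OF H(1) that]
    by (intro sigma_finite_subalgebra.real_cond_exp_intg(2)[OF sf] int
        borel_measurable_integrable[OF integrable_\<xi>]) auto
  show "integrable M (\<lambda>\<omega>. H \<omega> * (Y (Suc i) \<omega> - Y i \<omega>))"
    by (intro int Bochner_Integration.integrable_diff Y_integrable)
  show "(\<integral>\<omega>. H \<omega> * (Y (Suc i) \<omega> - Y i \<omega>) \<partial>M) = 0"
    using eq[of i] eq[of "Suc i"]
    by (simp add: right_diff_distrib Bochner_Integration.integral_diff[OF int int] Y_integrable)
qed

context
  fixes S :: "nat \<Rightarrow> 'a \<Rightarrow> bool"
  assumes S [measurable]: "\<And>i. Measurable.pred (F i) (S i)"
begin

abbreviation X :: "nat \<Rightarrow> 'a \<Rightarrow> real" where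
  "X i \<omega> \<equiv> stopped_seq (\<lambda>j. S j \<omega>) (\<lambda>j. Y j \<omega>) i"

lemma active_measurable: "Measurable.pred (F i) (\<lambda>\<omega>. \<forall>j\<le>i. \<not> S j \<omega>)"
proof -
  have [measurable]: "Measurable.pred (F i) (S j)" if "j \<in> {..i}" for j
    using measurable_filtration[OF S] that by simp
  have "Measurable.pred (F i) (\<lambda>\<omega>. \<forall>j\<in>{..i}. \<not> S j \<omega>)"
    by measurable
  then show ?thesis by (simp add: Ball_def)
qed

lemma X_measurable: "X i \<in> borel_measurable (F i)"
proof -
  have Y: "Y j \<in> borel_measurable (F i)" if "j \<le> i" for j
    using measurable_filtration[OF Y_measurable that] .
  have act: "Measurable.pred (F i) (\<lambda>\<omega>. \<forall>k\<le>j. \<not> S k \<omega>)" if "j \<le> i" for j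
    using measurable_filtration[OF active_measurable that] .
  show ?thesis
    unfolding stopped_seq_def
    by (intro borel_measurable_add borel_measurable_sum borel_measurable_times
        borel_measurable_diff measurable_real_of_bool Y act) auto
qed

text \<open>The gain of the strategy on the stopped sequence is a martingale transform of
  \<open>Y\<close> and has mean zero. Only the final shortfall, dominated by \<open>W\<close>,
  remains to pay for the upcrossings.\<close>

lemma stopped_upcrossing_inequality:
  fixes u :: nat
  assumes ab: "a < b" and W: "integrable M W" "AE \<omega> in M. max 0 (a - X n \<omega>) \<le> W \<omega>"
  shows "(b - a) * real u * prob {\<omega> \<in> space M. u \<le> upcrossings a b (\<lambda>j. X j \<omega>) n} \<le> (\<integral>\<omega>. W \<omega> \<partial>M)"
proof -
  let ?U = "\<lambda>\<omega>. upcrossings a b (\<lambda>j. X j \<omega>) n"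
  define H where "H i \<omega> = (of_bool (holding a b (\<lambda>j. X j \<omega>) i) * of_bool (\<forall>j\<le>i. \<not> S j \<omega>) :: real)"
    for i \<omega>
  have [measurable]: "?U \<in> measurable M (count_space UNIV)"
    by (intro upcrossings_measurable measurable_from_subalg[OF subalg X_measurable])
  have H: "H i \<in> borel_measurable (F i)" for i
    unfolding H_def
    by (intro borel_measurable_times measurable_real_of_bool active_measurable
        upcrossings_measurable measurable_filtration[OF X_measurable])
  have H1: "\<bar>H i \<omega>\<bar> \<le> 1" for i \<omega>
    by (simp add: H_def)
  \<comment> \<open>An increment of the stopped sequence is that of \<open>Y\<close> times the
    indicator of not having stopped, which \<open>H\<close> absorbs.\<close>
  have gain: "(\<Sum>i<n. of_bool (holding a b (\<lambda>j. X j \<omega>) i) * (X (Suc i) \<omega> - X i \<omega>))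
      = (\<Sum>i<n. H i \<omega> * (Y (Suc i) \<omega> - Y i \<omega>))" for \<omega>
    by (intro sum.cong) (auto simp: stopped_seq_def H_def)
  have intU: "integrable M (\<lambda>\<omega>. real (?U \<omega>))"
    by (rule integrable_const_bound[where B = n]) (auto simp: upcrossings_le)
  have intI: "integrable M (\<lambda>\<omega>. indicator {\<omega> \<in> space M. u \<le> ?U \<omega>} \<omega> :: real)"
    by (intro integrable_real_indicator) (auto simp: less_top[symmetric])
  \<comment> \<open>Markov's inequality for the number of upcrossings.\<close>
  have "real u * prob {\<omega> \<in> space M. u \<le> ?U \<omega>} = (\<integral>\<omega>. real u * indicator {\<omega> \<in> space M. u \<le> ?U \<omega>} \<omega> \<partial>M)"
    using intI by simp
  also have "\<dots> \<le> (\<integral>\<omega>. real (?U \<omega>) \<partial>M)"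
    by (intro integral_mono intU integrable_mult_right intI) (auto split: split_indicator)
  finally have "(b - a) * (real u * prob {\<omega> \<in> space M. u \<le> ?U \<omega>}) \<le> (b - a) * (\<integral>\<omega>. real (?U \<omega>) \<partial>M)"
    using ab by (intro mult_left_mono) auto
  also have "\<dots> = (\<integral>\<omega>. (b - a) * real (?U \<omega>) \<partial>M)"
    by simp
  also have "\<dots> \<le> (\<integral>\<omega>. (\<Sum>i<n. H i \<omega> * (Y (Suc i) \<omega> - Y i \<omega>)) + W \<omega> \<partial>M)"
  proof (intro integral_mono_AE)
    show "AE \<omega> in M. (b - a) * real (?U \<omega>) \<le> (\<Sum>i<n. H i \<omega> * (Y (Suc i) \<omega> - Y i \<omega>)) + W \<omega>"
      using W(2)
    proof eventually_elim
      case (elim \<omega>)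
      then show ?case
        using upcrossings_gain[OF ab, of "\<lambda>j. X j \<omega>" n] unfolding gain by linarith
    qed
  qed (use intU W(1) Y_increment(1)[OF H H1] in \<open>auto intro!: Bochner_Integration.integrable_add\<close>)
  also have "\<dots> = (\<integral>\<omega>. W \<omega> \<partial>M)"
    using W(1) Y_increment[OF H H1] by (simp add: Bochner_Integration.integral_add)
  finally show ?thesis by (simp add: mult.assoc)
qed

end

end

text \<open>The tail intersections increase, so continuity from below applies, and each is contained
  in its first set \<open>B m\<close>.\<close>

lemma (in finite_measure) measure_liminf_le:
  assumes B: "\<And>n::nat. B n \<in> sets M" and le: "\<And>n. measure M (B n) \<le> c + e n" and e: "e \<longlonglongrightarrow> 0"
  shows "measure M (\<Union>m. \<Inter>n\<in>{m..}. B n) \<le> c"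
proof -
  have C: "(\<Inter>n\<in>{m..}. B n) \<in> sets M" for m
    using B by (intro sets.countable_INT') auto
  have "(\<lambda>m. measure M (\<Inter>n\<in>{m..}. B n)) \<longlonglongrightarrow> measure M (\<Union>m. \<Inter>n\<in>{m..}. B n)"
    using C by (intro finite_Lim_measure_incseq) (auto simp: incseq_def)
  moreover have "(\<lambda>m. c + e m) \<longlonglongrightarrow> c"
    using tendsto_add[OF tendsto_const[of c] e] by simp
  moreover have "measure M (\<Inter>n\<in>{m..}. B n) \<le> c + e m" for m
  proof -
    have "measure M (\<Inter>n\<in>{m..}. B n) \<le> measure M (B m)"
      by (intro finite_measure_mono B) auto
    then show ?thesis
      using le[of m] by linarith
  qed
  ultimately show ?thesis
    by (intro LIMSEQ_le) auto
qed

section \<open>Oscillation of continuous functions along dyadic grids\<close>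

definition grid :: "nat \<Rightarrow> nat \<Rightarrow> real" where
  "grid n i = real i / 2 ^ n"

lemma grid_nonneg [simp]: "0 \<le> grid n i"
  by (simp add: grid_def)

lemma grid_mono: "i \<le> j \<Longrightarrow> grid n i \<le> grid n j"
  by (simp add: grid_def divide_right_mono)

lemma grid_zero [simp]: "grid n 0 = 0"
  by (simp add: grid_def)

lemma grid_nat [simp]: "grid n (T * 2 ^ n) = real T"
  by (simp add: grid_def)

lemma grid_floor_tendsto:
  assumes "0 \<le> t"
  shows "(\<lambda>n. grid n (nat \<lfloor>t * 2 ^ n\<rfloor>)) \<longlonglongrightarrow> t"
proof (rule real_tendsto_sandwich)
  have "(\<lambda>n. t - (1/2) ^ n) \<longlonglongrightarrow> t - 0"
    by (intro tendsto_diff tendsto_const LIMSEQ_power_zero) auto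
  then show "(\<lambda>n. t - (1/2) ^ n) \<longlonglongrightarrow> t" by simp
  show "(\<lambda>n. t) \<longlonglongrightarrow> t" by simp
  show "\<forall>\<^sub>F n in sequentially. t - (1/2) ^ n \<le> grid n (nat \<lfloor>t * 2 ^ n\<rfloor>)"
  proof (intro always_eventually allI)
    fix n
    have "t * 2 ^ n - 1 \<le> real (nat \<lfloor>t * 2 ^ n\<rfloor>)" by linarith
    then have "(t * 2 ^ n - 1) / 2 ^ n \<le> grid n (nat \<lfloor>t * 2 ^ n\<rfloor>)"
      unfolding grid_def by (intro divide_right_mono) auto
    then show "t - (1/2) ^ n \<le> grid n (nat \<lfloor>t * 2 ^ n\<rfloor>)"
      by (simp add: diff_divide_distrib power_one_over)
  qed
  show "\<forall>\<^sub>F n in sequentially. grid n (nat \<lfloor>t * 2 ^ n\<rfloor>) \<le> t"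
  proof (intro always_eventually allI)
    fix n
    have "real (nat \<lfloor>t * 2 ^ n\<rfloor>) \<le> t * 2 ^ n"
      using assms by (simp add: of_nat_nat)
    then show "grid n (nat \<lfloor>t * 2 ^ n\<rfloor>) \<le> t"
      by (simp add: grid_def pos_divide_le_eq)
  qed
qed

lemma continuous_on_grid_tendsto:
  fixes f :: "real \<Rightarrow> real"
  assumes "continuous_on {0..} f" "0 \<le> t"
  shows "(\<lambda>n. f (grid n (nat \<lfloor>t * 2 ^ n\<rfloor>))) \<longlonglongrightarrow> f t"
  by (rule continuous_on_tendsto_compose[OF assms(1) grid_floor_tendsto[OF assms(2)]]) (use assms in auto)

text \<open>The horizon is chosen first and the mesh second. Asking for all large horizons and all
  fine grids gives a condition that countable unions and intersections of events can mirror.\<close>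

definition eventually_upcrosses :: "real \<Rightarrow> real \<Rightarrow> nat \<Rightarrow> (real \<Rightarrow> real) \<Rightarrow> bool" where
  "eventually_upcrosses a b u f \<longleftrightarrow>
     (\<exists>R::nat. \<forall>T\<ge>R. \<forall>\<^sub>F n in sequentially. u \<le> upcrossings a b (\<lambda>i. f (grid n i)) (T * 2 ^ n))"

text \<open>The low value is required at the grid points approximating \<open>s\<close>. This covers
  both \<open>f s < a\<close>, by continuity, and the start \<open>s = 0\<close> with
  \<open>f 0 = a\<close>, where the approximating grid point is 0 itself.\<close>

lemma eventually_upcrosses_Suc:
  fixes f :: "real \<Rightarrow> real"
  assumes f: "continuous_on {0..} f" and "a < b" and st: "real R \<le> s" "s < t" "f t > b"
    and s: "\<forall>\<^sub>F n in sequentially. f (grid n (nat \<lfloor>s * 2 ^ n\<rfloor>)) \<le> a"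
    and u: "\<forall>\<^sub>F n in sequentially. u \<le> upcrossings a b (\<lambda>i. f (grid n i)) (R * 2 ^ n)"
    and T: "t \<le> real T"
  shows "\<forall>\<^sub>F n in sequentially. Suc u \<le> upcrossings a b (\<lambda>i. f (grid n i)) (T * 2 ^ n)"
proof -
  have s0: "0 \<le> s" "0 \<le> t"
    using st by auto
  \<comment> \<open>Once the mesh is below \<open>t - s\<close>, the grid indices approximating
    \<open>s\<close> and \<open>t\<close> are distinct.\<close>
  obtain n0 where n0: "(1/2::real) ^ n0 < t - s"
    using real_arch_pow_inv[of "t - s" "1/2"] st by auto
  have t: "\<forall>\<^sub>F n in sequentially. f (grid n (nat \<lfloor>t * 2 ^ n\<rfloor>)) > b"
    using order_tendstoD(1)[OF continuous_on_grid_tendsto[OF f \<open>0 \<le> t\<close>] st(3)] .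
  show ?thesis
    using u s t eventually_ge_at_top[of n0]
  proof eventually_elim
    case (elim n)
    let ?i = "nat \<lfloor>s * 2 ^ n\<rfloor>" and ?j = "nat \<lfloor>t * 2 ^ n\<rfloor>" and ?x = "\<lambda>i. f (grid n i)"
    have "(1/2::real) ^ n \<le> (1/2) ^ n0"
      using elim(4) by (intro power_decreasing) auto
    then have "1 / 2 ^ n < t - s"
      using n0 by (simp add: power_one_over)
    then have "1 < t * 2 ^ n - s * 2 ^ n"
      by (simp add: field_simps)
    then have "\<lfloor>s * 2 ^ n\<rfloor> < \<lfloor>t * 2 ^ n\<rfloor>" by linarith
    moreover have "0 \<le> \<lfloor>s * 2 ^ n\<rfloor>" using s0 by simp
    ultimately have "?i < ?j" by linarith
    \<comment> \<open>The low grid point comes after the horizon \<open>R\<close>, so the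
      \<open>u\<close> upcrossings counted before \<open>R\<close> are complete when the new one
      begins.\<close>
    have "real (R * 2 ^ n) \<le> s * 2 ^ n"
      using st(1) by simp
    then have "int (R * 2 ^ n) \<le> \<lfloor>s * 2 ^ n\<rfloor>"
      by (metis le_floor_iff of_int_of_nat_eq)
    then have Ri: "R * 2 ^ n \<le> ?i" by linarith
    have "t * 2 ^ n \<le> real (T * 2 ^ n)"
      using T by simp
    then have jT: "?j \<le> T * 2 ^ n" by linarith
    have "u \<le> upcrossings a b ?x ?i"
      using elim(1) upcrossings_mono[OF Ri] order.trans by blast
    also have "\<dots> < upcrossings a b ?x ?j"
      using upcrossings_crossing[OF \<open>a < b\<close> \<open>?i < ?j\<close>, of ?x] elim by auto
    also have "\<dots> \<le> upcrossings a b ?x (T * 2 ^ n)"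
      using upcrossings_mono[OF jT] .
    finally show ?case by simp
  qed
qed

text \<open>Beyond the horizon that yields \<open>u\<close> upcrossings, \<open>f\<close> falls
  below \<open>a\<close> again and later exceeds \<open>b\<close>.\<close>

lemma eventually_upcrosses_if_oscillates:
  fixes f :: "real \<Rightarrow> real"
  assumes f: "continuous_on {0..} f" and "a < b"
    and "\<exists>\<^sub>F t in at_top. f t < a" "\<exists>\<^sub>F t in at_top. b < f t"
  shows "eventually_upcrosses a b u f"
proof (induction u)
  case 0
  then show ?case by (simp add: eventually_upcrosses_def)
next
  case (Suc u)
  then obtain R where R: "\<forall>T\<ge>R. \<forall>\<^sub>F n in sequentially. u \<le> upcrossings a b (\<lambda>i. f (grid n i)) (T * 2 ^ n)"
    by (auto simp: eventually_upcrosses_def)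
  obtain s where s: "real R \<le> s" "f s < a"
    using assms(3) unfolding frequently_def eventually_at_top_linorder by (meson not_less)
  obtain t where "s + 1 \<le> t" "b < f t"
    using assms(4) unfolding frequently_def eventually_at_top_linorder by (meson not_less)
  moreover obtain K where "t \<le> real K"
    using real_arch_simple by blast
  moreover have "\<forall>\<^sub>F n in sequentially. f (grid n (nat \<lfloor>s * 2 ^ n\<rfloor>)) \<le> a"
    using order_tendstoD(2)[OF continuous_on_grid_tendsto[OF f] s(2)] s(1)
    by (auto elim!: eventually_mono)
  ultimately show ?case
    using R s(1) \<open>a < b\<close> unfolding eventually_upcrosses_def
    by (intro exI[of _ K] allI impI eventually_upcrosses_Suc[OF f, of a b R s t]) auto
qed

text \<open>The path starts at 0, so exceeding \<open>b\<close> completes an upcrossing from 0 to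
  \<open>b\<close> that begins at time 0. This lets the upcrossing inequality serve as a maximal
  inequality.\<close>

lemma eventually_upcrosses_if_exceeds:
  fixes f :: "real \<Rightarrow> real"
  assumes f: "continuous_on {0..} f" and "f 0 = 0" "0 < b" "0 \<le> t" "b < f t"
  shows "eventually_upcrosses 0 b 1 f"
proof -
  have "t \<noteq> 0" using assms by auto
  obtain K where "t \<le> real K"
    using real_arch_simple by blast
  then show ?thesis
    using assms \<open>t \<noteq> 0\<close> unfolding eventually_upcrosses_def One_nat_def
    by (intro exI[of _ K] allI impI eventually_upcrosses_Suc[OF f, of 0 b 0 0 t]) auto
qed

text \<open>If the lower and upper limits differed, two rationals would separate them; rational
  levels leave only countably many null sets to discard. The bounds make the common limit
  finite.\<close>

lemma converges_if_bounded_not_oscillating: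
  fixes f :: "real \<Rightarrow> real"
  assumes lb: "\<And>t. 0 \<le> t \<Longrightarrow> l \<le> f t" and ub: "\<And>t. 0 \<le> t \<Longrightarrow> f t \<le> h"
    and osc: "\<And>a b :: rat. a < b \<Longrightarrow>
      \<not> ((\<exists>\<^sub>F t in at_top. f t < of_rat a) \<and> (\<exists>\<^sub>F t in at_top. of_rat b < f t))"
  shows "\<exists>c. (f \<longlongrightarrow> c) at_top"
proof -
  let ?g = "\<lambda>t. ereal (f t)"
  have "Limsup at_top ?g \<le> Liminf at_top ?g"
  proof (rule ccontr)
    assume "\<not> ?thesis"
    \<comment> \<open>The limits may be infinite, so real separators \<open>w\<close>,
      \<open>z\<close>, \<open>z'\<close> are found first and rationals are placed between
      them.\<close>
    then obtain z where z: "Liminf at_top ?g < ereal z" "ereal z < Limsup at_top ?g"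
      using ereal_dense2[of "Liminf at_top ?g" "Limsup at_top ?g"] unfolding not_le by blast
    obtain z' where z': "ereal z < ereal z'" "ereal z' < Limsup at_top ?g"
      using ereal_dense2[OF z(2)] by blast
    obtain b where b: "z < of_rat b" "of_rat b < z'"
      using z'(1) of_rat_dense by auto
    obtain w where w: "Liminf at_top ?g < ereal w" "ereal w < ereal z"
      using ereal_dense2[OF z(1)] by blast
    obtain a where a: "w < of_rat a" "of_rat a < z"
      using w(2) of_rat_dense by auto
    have "(of_rat a :: real) < of_rat b" using a b by linarith
    then have "a < b" by (simp add: of_rat_less)
    moreover have "\<exists>\<^sub>F t in at_top. f t < of_rat a"
    proof (rule ccontr)
      assume "\<not> ?thesis"
      then have "\<forall>\<^sub>F t in at_top. ereal (of_rat a) \<le> ?g t"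
        by (auto simp: not_frequently not_less)
      then have "ereal (of_rat a) \<le> Liminf at_top ?g"
        by (rule Liminf_bounded)
      then show False using w(1) a(1) by (meson ereal_less_eq(3) less_le_trans not_less order_less_imp_le)
    qed
    moreover have "\<exists>\<^sub>F t in at_top. of_rat b < f t"
    proof (rule ccontr)
      assume "\<not> ?thesis"
      then have "\<forall>\<^sub>F t in at_top. ?g t \<le> ereal (of_rat b)"
        by (auto simp: not_frequently not_less)
      then have "Limsup at_top ?g \<le> ereal (of_rat b)"
        by (rule Limsup_bounded)
      then show False using z'(2) b(2) by (meson ereal_less_eq(3) le_less_trans not_less order_less_imp_le)
    qed
    ultimately show False using osc by blast
  qed
  then have "Limsup at_top ?g = Liminf at_top ?g"
    using Liminf_le_Limsup[of at_top ?g] by (intro antisym) auto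
  then have lim: "(?g \<longlongrightarrow> Liminf at_top ?g) at_top"
    by (intro Liminf_eq_Limsup) auto
  have ev: "\<forall>\<^sub>F t in at_top. ereal l \<le> ?g t" "\<forall>\<^sub>F t in at_top. ?g t \<le> ereal h"
    by (auto intro: eventually_mono[OF eventually_ge_at_top[of 0]] lb ub)
  have "ereal l \<le> Liminf at_top ?g"
    using ev(1) by (rule Liminf_bounded)
  moreover have "Liminf at_top ?g \<le> ereal h"
    by (rule tendsto_upperbound[OF lim ev(2)]) simp
  ultimately obtain c where "Liminf at_top ?g = ereal c"
    by (cases "Liminf at_top ?g") auto
  then show ?thesis using lim by auto
qed

section \<open>Convergence under a single measure\<close>

lemma nondecreasing_from_0_le:
  assumes "nondecreasing_from_0 f" "0 \<le> s" "s \<le> t"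
  shows "f s \<le> f t"
  using assms by (auto simp: nondecreasing_from_0_def intro: mono_onD)

text \<open>\<open>P\<close> stands for the completion of one representing measure, and quasi-sure
  hypotheses become almost sure ones. \<open>Z\<close> and \<open>A2\<close> enter only through
  \<open>nonneg\<close>, which expresses that their sum is non-negative.\<close>

locale stopped_martingale = prob_space P for P :: "'m::finite path measure" +
  fixes \<G> :: "real \<Rightarrow> 'm path measure" and A M :: "real \<Rightarrow> 'm path \<Rightarrow> real"
    and Z0 :: "'m path \<Rightarrow> real" and \<tau> :: "nat \<Rightarrow> 'm path \<Rightarrow> ennreal"
  assumes subalg: "\<And>t. subalgebra P (\<G> t)"
    and filtration: "\<And>s t. s \<le> t \<Longrightarrow> subalgebra (\<G> t) (\<G> s)"
    and adapted_A: "\<And>t. 0 \<le> t \<Longrightarrow> A t \<in> borel_measurable (\<G> t)"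
    and nondecreasing_A: "AE \<omega> in P. nondecreasing_from_0 (\<lambda>t. A t \<omega>)"
    and continuous_A: "AE \<omega> in P. continuous_on {0..} (\<lambda>t. A t \<omega>)"
    and integrable_Z0: "integrable P Z0"
    and nonneg: "AE \<omega> in P. \<forall>t\<ge>0. 0 \<le> Z0 \<omega> + A t \<omega> + M t \<omega>"
    and zero_M: "AE \<omega> in P. M 0 \<omega> = 0"
    and continuous_M: "AE \<omega> in P. continuous_on {0..} (\<lambda>t. M t \<omega>)"
    and measurable_\<tau>: "\<And>N t. 0 \<le> t \<Longrightarrow> {\<omega> \<in> space P. \<tau> N \<omega> \<le> ennreal t} \<in> sets P"
    and \<tau>_tendsto: "AE \<omega> in P. (\<lambda>N. \<tau> N \<omega>) \<longlonglongrightarrow> \<infinity>"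
    and integrable_stopped: "\<And>N t. 0 \<le> t \<Longrightarrow> integrable P (stopped M (\<tau> N) t)"
    and martingale: "\<And>N s t. 0 \<le> s \<Longrightarrow> s \<le> t \<Longrightarrow>
           AE \<omega> in P. real_cond_exp P (\<G> s) (stopped M (\<tau> N) t) \<omega> = stopped M (\<tau> N) s \<omega>"
begin

lemma A_measurable: "0 \<le> t \<Longrightarrow> A t \<in> borel_measurable P"
  using measurable_from_subalg[OF subalg adapted_A] .

text \<open>Stopping once \<open>A\<close> is at least \<open>k\<close> would leave the overshoot
  uncontrolled. Stopping in a window of length 1 keeps \<open>A\<close> at most \<open>k + 1\<close>
  at the stop; this event is the price.\<close>

definition jumped :: "real \<Rightarrow> nat \<Rightarrow> nat \<Rightarrow> 'm path set" where
  "jumped k T n = {\<omega> \<in> space P. k + 1 < A T \<omega> \<and> (\<forall>j<T * 2 ^ n. A (grid n j) \<omega> \<notin> {k..k+1})}"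

lemma jumped_sets [measurable]: "jumped k T n \<in> sets P"
proof -
  have [measurable]: "A (grid n j) \<in> borel_measurable P" "A (real T) \<in> borel_measurable P" for j
    by (simp_all add: A_measurable)
  have "{\<omega> \<in> space P. k + 1 < A T \<omega> \<and> (\<forall>j\<in>{..<T * 2 ^ n}. A (grid n j) \<omega> \<notin> {k..k+1})} \<in> sets P"
    by measurable
  then show ?thesis
    by (simp add: jumped_def Ball_def)
qed

text \<open>A continuous path of \<open>A\<close> belongs to \<open>jumped\<close> only for finitely
  many \<open>n\<close>; then dominated convergence with majorant \<open>\<bar>\<xi>\<bar>\<close>
  applies.\<close>

lemma integral_jumped_tendsto_0:
  fixes \<xi> :: "'m path \<Rightarrow> real"
  assumes \<xi>: "integrable P \<xi>" and "0 < k"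
  shows "(\<lambda>n. \<integral>\<omega>. \<bar>\<xi> \<omega>\<bar> * indicator (jumped k T n) \<omega> \<partial>P) \<longlonglongrightarrow> 0"
proof -
  have "(\<lambda>n. \<integral>\<omega>. \<bar>\<xi> \<omega>\<bar> * indicator (jumped k T n) \<omega> \<partial>P) \<longlonglongrightarrow> (\<integral>\<omega>. 0 \<partial>P)"
  proof (rule integral_dominated_convergence[where w = "\<lambda>\<omega>. \<bar>\<xi> \<omega>\<bar>"])
    show "AE \<omega> in P. (\<lambda>n. \<bar>\<xi> \<omega>\<bar> * indicator (jumped k T n) \<omega>) \<longlonglongrightarrow> 0"
      using nondecreasing_A continuous_A
    proof eventually_elim
      case (elim \<omega>)
      have "\<forall>\<^sub>F n in sequentially. \<omega> \<notin> jumped k T n"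
      proof (cases "k + 1 < A T \<omega>")
        case True
        \<comment> \<open>The midpoint of the window is interior, so grid points close to
          \<open>t\<close> have values in the window too.\<close>
        have "\<exists>t\<ge>0. t \<le> real T \<and> A t \<omega> = k + 1/2"
          using elim True \<open>0 < k\<close>
          by (intro IVT') (auto simp: nondecreasing_from_0_def intro: continuous_on_subset)
        then obtain t where t: "0 \<le> t" "t \<le> real T" "A t \<omega> = k + 1/2"
          by blast
        have lim: "(\<lambda>n. A (grid n (nat \<lfloor>t * 2 ^ n\<rfloor>)) \<omega>) \<longlonglongrightarrow> k + 1/2"
          using continuous_on_grid_tendsto[OF elim(2) t(1)] t(3) by simp
        \<comment> \<open>\<open>jumped\<close> looks only at indices strictly before the horizon,
          so \<open>t\<close> must lie strictly before \<open>T\<close>.\<close>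
        have "t \<noteq> real T" using t True by auto
        then have "t * 2 ^ n < real (T * 2 ^ n)" for n
          using t by simp
        then have less: "nat \<lfloor>t * 2 ^ n\<rfloor> < T * 2 ^ n" for n
          using t(1) by (smt (verit) floor_less_iff nat_less_iff of_int_of_nat_eq zero_le_floor zero_le_mult_iff zero_le_power)
        have "\<forall>\<^sub>F n in sequentially. k < A (grid n (nat \<lfloor>t * 2 ^ n\<rfloor>)) \<omega>"
            "\<forall>\<^sub>F n in sequentially. A (grid n (nat \<lfloor>t * 2 ^ n\<rfloor>)) \<omega> < k + 1"
          using order_tendstoD[OF lim] by simp_all
        then show ?thesis
        proof eventually_elim
          case (elim n)
          then show ?case
            using less[of n] by (auto simp: jumped_def intro: less_imp_le)
        qed
      qed (simp add: jumped_def)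
      then show ?case
        by (intro tendsto_eventually) (erule eventually_mono, simp)
    qed
  qed (use \<xi> in \<open>auto split: split_indicator\<close>)
  then show ?thesis by simp
qed

text \<open>Apply non-negativity at the stopped time, which is at most \<open>t\<close>, and use
  that \<open>A\<close> is nondecreasing.\<close>

lemma stopped_lower_bound:
  assumes "nondecreasing_from_0 (\<lambda>t. A t \<omega>)" "\<forall>t\<ge>0. 0 \<le> Z0 \<omega> + A t \<omega> + M t \<omega>" "0 \<le> t"
  shows "- \<bar>Z0 \<omega>\<bar> - A t \<omega> \<le> stopped M (\<tau> N) t \<omega>"
proof -
  let ?r = "enn2real (min (ennreal t) (\<tau> N \<omega>))"
  have "?r \<le> enn2real (ennreal t)"
    by (intro enn2real_mono) auto
  then have r: "0 \<le> ?r" "?r \<le> t"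
    using assms(3) by auto
  then have "A ?r \<omega> \<le> A t \<omega>"
    by (rule nondecreasing_from_0_le[OF assms(1)])
  moreover have "0 \<le> Z0 \<omega> + A ?r \<omega> + M ?r \<omega>"
    using assms(2) r(1) by blast
  ultimately show ?thesis
    by (simp add: stopped_def)
qed

section \<open>Upcrossings on one grid up to a fixed horizon\<close>

definition crossing_event :: "real \<Rightarrow> real \<Rightarrow> nat \<Rightarrow> real \<Rightarrow> nat \<Rightarrow> nat \<Rightarrow> nat \<Rightarrow> 'm path set" where
  "crossing_event a b u k T N n = {\<omega> \<in> space P. A T \<omega> < k \<and> \<not> \<tau> N \<omega> \<le> ennreal T \<and>
     u \<le> upcrossings a b (\<lambda>i. stopped M (\<tau> N) (grid n i) \<omega>) (T * 2 ^ n)}"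

lemma crossing_event_sets [measurable]: "crossing_event a b u k T N n \<in> sets P"
proof -
  have [measurable]: "A (real T) \<in> borel_measurable P"
    by (simp add: A_measurable)
  have [measurable]: "Measurable.pred P (\<lambda>\<omega>. \<tau> N \<omega> \<le> ennreal (real T))"
    using measurable_\<tau> by (simp add: pred_def)
  have [measurable]: "(\<lambda>\<omega>. upcrossings a b (\<lambda>i. stopped M (\<tau> N) (grid n i) \<omega>) (T * 2 ^ n))
      \<in> measurable P (count_space UNIV)"
    by (intro upcrossings_measurable borel_measurable_integrable integrable_stopped) simp
  show ?thesis
    unfolding crossing_event_def by measurable
qed

text \<open>The upcrossing inequality is applied on the grid to the martingale closed by its value
  at \<open>T\<close> and stopped when \<open>A\<close> enters the window. On the event considered,
  \<open>A\<close> stays below \<open>k\<close> and this stopping never takes effect.\<close>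

lemma crossing_event_bound:
  assumes "a < b" "0 < k"
  shows "(b - a) * real u * prob (crossing_event a b u k T N n)
    \<le> (\<integral>\<omega>. \<bar>Z0 \<omega>\<bar> \<partial>P) + \<bar>a\<bar> + k + 1
       + (\<integral>\<omega>. \<bar>stopped M (\<tau> N) T \<omega>\<bar> * indicator (jumped k T n) \<omega> \<partial>P)"
proof -
  let ?\<xi> = "stopped M (\<tau> N) (real T)" and ?n = "T * 2 ^ n"
  interpret cm: closed_martingale P "\<lambda>i. \<G> (grid n i)" ?\<xi>
    by unfold_locales (auto simp: subalg filtration grid_mono integrable_stopped)
  define S where "S i \<omega> \<longleftrightarrow> A (grid n i) \<omega> \<in> {k..k+1}" for i \<omega>
  have S: "Measurable.pred (\<G> (grid n i)) (S i)" for i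
  proof -
    have [measurable]: "A (grid n i) \<in> borel_measurable (\<G> (grid n i))"
      by (simp add: adapted_A)
    show ?thesis unfolding S_def by measurable
  qed
  define X where "X i \<omega> = stopped_seq (\<lambda>j. S j \<omega>) (\<lambda>j. cm.Y j \<omega>) i" for i \<omega>
  \<comment> \<open>The first summands majorise the shortfall when \<open>A\<close> is at most
    \<open>k + 1\<close> at the final index; the last one does so when the window was missed, where
    the final value is \<open>?\<xi>\<close>.\<close>
  let ?W = "\<lambda>\<omega>. \<bar>Z0 \<omega>\<bar> + (\<bar>a\<bar> + k + 1) + \<bar>?\<xi> \<omega>\<bar> * indicator (jumped k T n) \<omega>"
  have intJ: "integrable P (\<lambda>\<omega>. \<bar>?\<xi> \<omega>\<bar> * indicator (jumped k T n) \<omega>)"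
    by (intro integrable_real_mult_indicator integrable_abs cm.integrable_\<xi>) measurable
  have intW: "integrable P ?W"
    using intJ integrable_Z0 by (intro Bochner_Integration.integrable_add integrable_abs) auto
  have "AE \<omega> in P. \<forall>i. i \<le> ?n \<longrightarrow> cm.Y i \<omega> = stopped M (\<tau> N) (grid n i) \<omega>"
  proof (unfold AE_all_countable, intro allI)
    fix i
    show "AE \<omega> in P. i \<le> ?n \<longrightarrow> cm.Y i \<omega> = stopped M (\<tau> N) (grid n i) \<omega>"
    proof (cases "i \<le> ?n")
      case True
      then have "grid n i \<le> real T"
        using grid_mono[OF True, of n] by simp
      from martingale[OF _ this, of N] show ?thesis
        by (simp add: cm.Y_def)
    qed simp
  qed
  note Y = this
  have "AE \<omega> in P. max 0 (a - X ?n \<omega>) \<le> ?W \<omega>"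
    using Y nondecreasing_A nonneg AE_space
  proof eventually_elim
    case (elim \<omega>)
    obtain m where m: "m \<le> ?n" "X ?n \<omega> = cm.Y m \<omega>" "S m \<omega> \<or> m = ?n \<and> (\<forall>j<?n. \<not> S j \<omega>)"
      unfolding X_def by (rule stopped_seq_value)
    have x: "X ?n \<omega> = stopped M (\<tau> N) (grid n m) \<omega>"
      using elim(1) m by simp
    have lb: "- \<bar>Z0 \<omega>\<bar> - A (grid n m) \<omega> \<le> X ?n \<omega>"
      unfolding x by (rule stopped_lower_bound[OF elim(2,3)]) simp
    have i0: "0 \<le> \<bar>?\<xi> \<omega>\<bar> * indicator (jumped k T n) \<omega>" by simp
    show ?case
    proof (cases "A (grid n m) \<omega> \<le> k + 1")
      case True
      then show ?thesis using lb i0 \<open>0 < k\<close> by linarith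
    next
      case False
      \<comment> \<open>A value of \<open>A\<close> above \<open>k + 1\<close> rules out a stop at
        \<open>m\<close>, so the grid was traversed up to \<open>T\<close> without a visit to the
        window.\<close>
      then have "\<not> S m \<omega>" by (auto simp: S_def)
      then have "m = ?n" "\<forall>j<?n. \<not> S j \<omega>" using m by auto
      then have "\<omega> \<in> jumped k T n" and "X ?n \<omega> = ?\<xi> \<omega>"
        using False elim(4) x by (auto simp: jumped_def S_def)
      then have "\<bar>X ?n \<omega>\<bar> = \<bar>?\<xi> \<omega>\<bar> * indicator (jumped k T n) \<omega>"
        by simp
      then show ?thesis using \<open>0 < k\<close> by linarith
    qed
  qed
  from cm.stopped_upcrossing_inequality[OF S \<open>a < b\<close> intW this[unfolded X_def], of u]
  have "(b - a) * real u * prob {\<omega> \<in> space P. u \<le> upcrossings a b (\<lambda>i. X i \<omega>) ?n} \<le> (\<integral>\<omega>. ?W \<omega> \<partial>P)"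
    by (simp add: X_def)
  \<comment> \<open>Monotonicity keeps \<open>A\<close> below \<open>k\<close> at all grid points up
    to \<open>T\<close>, so \<open>X\<close> equals the original process there and has the same
    upcrossings.\<close>
  moreover have "prob (crossing_event a b u k T N n) \<le> prob {\<omega> \<in> space P. u \<le> upcrossings a b (\<lambda>i. X i \<omega>) ?n}"
  proof (rule finite_measure_mono_AE)
    show "AE \<omega> in P. \<omega> \<in> crossing_event a b u k T N n \<longrightarrow>
        \<omega> \<in> {\<omega> \<in> space P. u \<le> upcrossings a b (\<lambda>i. X i \<omega>) ?n}"
      using Y nondecreasing_A
    proof eventually_elim
      case (elim \<omega>)
      show ?case
      proof
        assume \<omega>: "\<omega> \<in> crossing_event a b u k T N n"
        have "X i \<omega> = stopped M (\<tau> N) (grid n i) \<omega>" if "i \<le> ?n" for i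
        proof -
          have "\<not> S j \<omega>" if "j \<le> ?n" for j
          proof -
            have "A (grid n j) \<omega> \<le> A T \<omega>"
              using nondecreasing_from_0_le[OF elim(2)] grid_mono[OF that, of n] by simp
            then show ?thesis
              using \<omega> by (auto simp: S_def crossing_event_def)
          qed
          then have "X i \<omega> = cm.Y i \<omega>"
            unfolding X_def using that by (intro stopped_seq_not_stopped) auto
          then show ?thesis using elim(1) that by simp
        qed
        then show "\<omega> \<in> {\<omega> \<in> space P. u \<le> upcrossings a b (\<lambda>i. X i \<omega>) ?n}"
          using \<omega> upcrossings_cong[of ?n "\<lambda>i. X i \<omega>" "\<lambda>i. stopped M (\<tau> N) (grid n i) \<omega>"]
          by (simp add: crossing_event_def)
      qed
    qed
    have [measurable]: "(\<lambda>\<omega>. upcrossings a b (\<lambda>i. X i \<omega>) ?n) \<in> measurable P (count_space UNIV)"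
      unfolding X_def
      by (intro upcrossings_measurable measurable_from_subalg[OF subalg cm.X_measurable] S)
    show "{\<omega> \<in> space P. u \<le> upcrossings a b (\<lambda>i. X i \<omega>) ?n} \<in> sets P"
      by measurable
  qed
  ultimately have "(b - a) * real u * prob (crossing_event a b u k T N n) \<le> (\<integral>\<omega>. ?W \<omega> \<partial>P)"
    using \<open>a < b\<close> by (meson order.trans mult_left_mono mult_nonneg_nonneg of_nat_0_le_iff diff_ge_0_iff_ge less_imp_le)
  also have "\<dots> = (\<integral>\<omega>. \<bar>Z0 \<omega>\<bar> \<partial>P) + \<bar>a\<bar> + k + 1
       + (\<integral>\<omega>. \<bar>?\<xi> \<omega>\<bar> * indicator (jumped k T n) \<omega> \<partial>P)"
    using intJ integrable_Z0 by (simp add: prob_space)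
  finally show ?thesis .
qed

section \<open>From grids and finite horizons to whole paths\<close>

definition limit_event :: "real \<Rightarrow> real \<Rightarrow> nat \<Rightarrow> real \<Rightarrow> 'm path set" where
  "limit_event a b u k = (\<Union>R. \<Inter>T\<in>{R..}. \<Union>N0. \<Inter>N\<in>{N0..}. \<Union>n0. \<Inter>n\<in>{n0..}. crossing_event a b u k T N n)"

lemma Inter_atLeast_sets:
  fixes B :: "nat \<Rightarrow> 'm path set"
  shows "(\<And>n. B n \<in> sets P) \<Longrightarrow> (\<Inter>n\<in>{m..}. B n) \<in> sets P"
  by (intro sets.countable_INT') auto

lemma limit_event_sets [measurable]: "limit_event a b u k \<in> sets P"
  unfolding limit_event_def by (intro sets.countable_UN' Inter_atLeast_sets) auto

text \<open>\<open>measure_liminf_le\<close> is applied from the inside out. With \<open>T\<close>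
  and \<open>N\<close> fixed, the error from \<open>jumped\<close> vanishes as \<open>n\<close>
  grows, which is why the mesh is innermost; the bound left over depends on neither \<open>T\<close>
  nor \<open>N\<close>.\<close>

lemma limit_event_bound:
  assumes "a < b" "0 < k" "0 < u"
  shows "prob (limit_event a b u k) \<le> ((\<integral>\<omega>. \<bar>Z0 \<omega>\<bar> \<partial>P) + \<bar>a\<bar> + k + 1) / ((b - a) * real u)"
    (is "_ \<le> ?c")
proof -
  have pos: "0 < (b - a) * real u" using assms by simp
  have le: "prob (crossing_event a b u k T N n) \<le> ?c
      + (\<integral>\<omega>. \<bar>stopped M (\<tau> N) T \<omega>\<bar> * indicator (jumped k T n) \<omega> \<partial>P) / ((b - a) * real u)" for T N n
    using crossing_event_bound[OF assms(1,2), of u T N n] pos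
    by (simp add: add_divide_distrib[symmetric] pos_le_divide_eq mult.commute)
  then have 1: "prob (\<Union>n0. \<Inter>n\<in>{n0..}. crossing_event a b u k T N n) \<le> ?c" for T N
    by (intro measure_liminf_le[OF crossing_event_sets le] tendsto_divide_zero
        integral_jumped_tendsto_0 integrable_stopped \<open>0 < k\<close>) simp
  have S1: "(\<Union>n0. \<Inter>n\<in>{n0..}. crossing_event a b u k T N n) \<in> sets P" for T N
    by (intro sets.countable_UN' Inter_atLeast_sets) auto
  have 2: "prob (\<Union>N0. \<Inter>N\<in>{N0..}. \<Union>n0. \<Inter>n\<in>{n0..}. crossing_event a b u k T N n) \<le> ?c" for T
    by (rule measure_liminf_le[OF S1, where e = "\<lambda>_. 0"]) (simp_all add: 1)
  have S2: "(\<Union>N0. \<Inter>N\<in>{N0..}. \<Union>n0. \<Inter>n\<in>{n0..}. crossing_event a b u k T N n) \<in> sets P" for T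
    by (intro sets.countable_UN' Inter_atLeast_sets) auto
  show ?thesis
    unfolding limit_event_def
    by (rule measure_liminf_le[OF S2, where e = "\<lambda>_. 0"]) (simp_all add: 2)
qed

text \<open>For each large \<open>T\<close>, \<open>\<tau> N\<close> exceeds \<open>T\<close> for
  all large \<open>N\<close>; then the stopped process equals \<open>M\<close> on the grid up to
  \<open>T\<close>.\<close>

lemma limit_event_if_upcrosses:
  assumes \<omega>: "\<omega> \<in> space P" and A: "\<forall>t\<ge>0. A t \<omega> < k" and \<tau>: "(\<lambda>N. \<tau> N \<omega>) \<longlonglongrightarrow> \<infinity>"
    and up: "eventually_upcrosses a b u (\<lambda>t. M t \<omega>)"
  shows "\<omega> \<in> limit_event a b u k"
proof -
  obtain R where R: "\<And>T. T \<ge> R \<Longrightarrow>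
      \<forall>\<^sub>F n in sequentially. u \<le> upcrossings a b (\<lambda>i. M (grid n i) \<omega>) (T * 2 ^ n)"
    using up by (auto simp: eventually_upcrosses_def)
  have "\<forall>\<^sub>F N in sequentially. \<forall>\<^sub>F n in sequentially. \<omega> \<in> crossing_event a b u k T N n"
    if "T \<ge> R" for T
  proof -
    have "\<forall>\<^sub>F N in sequentially. ennreal (real T) < \<tau> N \<omega>"
      using order_tendstoD(1)[OF \<tau>, of "ennreal (real T)"] by simp
    then show ?thesis
    proof eventually_elim
      case (elim N)
      have eq: "upcrossings a b (\<lambda>i. stopped M (\<tau> N) (grid n i) \<omega>) (T * 2 ^ n)
          = upcrossings a b (\<lambda>i. M (grid n i) \<omega>) (T * 2 ^ n)" for n
      proof (rule upcrossings_cong)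
        fix i assume "i \<le> T * 2 ^ n"
        then have "ennreal (grid n i) \<le> ennreal (real T)"
          using grid_mono[of i "T * 2 ^ n" n] by (intro ennreal_leI) simp
        then have "ennreal (grid n i) < \<tau> N \<omega>"
          using elim by (rule le_less_trans)
        then have "min (ennreal (grid n i)) (\<tau> N \<omega>) = ennreal (grid n i)"
          by simp
        then show "stopped M (\<tau> N) (grid n i) \<omega> = M (grid n i) \<omega>"
          by (simp add: stopped_def)
      qed
      show ?case
        using R[OF that] by eventually_elim (use \<omega> A elim in \<open>auto simp: crossing_event_def eq not_le\<close>)
    qed
  qed
  then have "\<forall>T\<in>{R..}. \<exists>N0. \<forall>N\<in>{N0..}. \<exists>n0. \<forall>n\<in>{n0..}. \<omega> \<in> crossing_event a b u k T N n"
    by (simp only: eventually_sequentially atLeast_iff Ball_def) blast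
  then show ?thesis
    unfolding limit_event_def UN_iff INT_iff by (intro bexI[of _ R] UNIV_I) simp
qed

section \<open>Almost sure boundedness and convergence of M\<close>

lemma AE_not_oscillating:
  assumes "a < b" "0 < k"
  shows "AE \<omega> in P. (\<forall>t\<ge>0. A t \<omega> < k) \<longrightarrow>
    \<not> ((\<exists>\<^sub>F t in at_top. M t \<omega> < a) \<and> (\<exists>\<^sub>F t in at_top. b < M t \<omega>))"
proof -
  let ?E = "\<Inter>u. limit_event a b (Suc u) k"
  let ?c = "((\<integral>\<omega>. \<bar>Z0 \<omega>\<bar> \<partial>P) + \<bar>a\<bar> + k + 1) / (b - a)"
  have E: "?E \<in> sets P"
    by (intro sets.countable_INT') auto
  \<comment> \<open>An oscillating path makes every number of upcrossings, and the probability of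
    \<open>Suc u\<close> of them decays like the reciprocal of \<open>Suc u\<close>.\<close>
  have "prob ?E \<le> ?c / real (Suc u)" for u
  proof -
    have "prob ?E \<le> prob (limit_event a b (Suc u) k)"
      by (intro finite_measure_mono) auto
    also have "\<dots> \<le> ?c / real (Suc u)"
      using limit_event_bound[OF assms, of "Suc u"] by (simp only: divide_divide_eq_left)
    finally show ?thesis .
  qed
  moreover have "(\<lambda>u. ?c / real (Suc u)) \<longlonglongrightarrow> 0"
    using LIMSEQ_Suc[OF lim_const_over_n[of ?c]] .
  ultimately have "prob ?E \<le> 0"
    by (intro LIMSEQ_le_const) auto
  then have "?E \<in> null_sets P"
    using E by (intro null_setsI) (auto simp: emeasure_eq_measure measure_le_0_iff)
  from AE_not_in[OF this] \<tau>_tendsto continuous_M AE_space show ?thesis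
  proof eventually_elim
    case (elim \<omega>)
    then show ?case
      using limit_event_if_upcrosses[of \<omega> k a b]
        eventually_upcrosses_if_oscillates[of "\<lambda>t. M t \<omega>" a b] \<open>a < b\<close> by blast
  qed
qed

text \<open>A path unbounded above makes one upcrossing from 0 to every level. With
  \<open>a = 0\<close> the bound on that probability is a constant divided by the level.\<close>

lemma AE_bounded_above:
  assumes "0 < k"
  shows "AE \<omega> in P. (\<forall>t\<ge>0. A t \<omega> < k) \<longrightarrow> (\<exists>h. \<forall>t\<ge>0. M t \<omega> \<le> h)"
proof -
  let ?E = "\<Inter>h. limit_event 0 (real (Suc h)) 1 k"
  let ?c = "(\<integral>\<omega>. \<bar>Z0 \<omega>\<bar> \<partial>P) + k + 1"
  have E: "?E \<in> sets P"
    by (intro sets.countable_INT') auto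
  have "prob ?E \<le> ?c / real (Suc h)" for h
  proof -
    have "prob ?E \<le> prob (limit_event 0 (real (Suc h)) 1 k)"
      by (intro finite_measure_mono) auto
    also have "\<dots> \<le> ?c / real (Suc h)"
      using limit_event_bound[of 0 "real (Suc h)" k 1] assms by simp
    finally show ?thesis .
  qed
  moreover have "(\<lambda>h. ?c / real (Suc h)) \<longlonglongrightarrow> 0"
    using LIMSEQ_Suc[OF lim_const_over_n[of ?c]] .
  ultimately have "prob ?E \<le> 0"
    by (intro LIMSEQ_le_const) auto
  then have "?E \<in> null_sets P"
    using E by (intro null_setsI) (auto simp: emeasure_eq_measure measure_le_0_iff)
  from AE_not_in[OF this] \<tau>_tendsto continuous_M zero_M AE_space show ?thesis
  proof eventually_elim
    case (elim \<omega>)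
    show ?case
    proof (intro impI)
      assume A: "\<forall>t\<ge>0. A t \<omega> < k"
      obtain h where "\<omega> \<notin> limit_event 0 (real (Suc h)) 1 k"
        using elim(1) by blast
      then have "\<not> eventually_upcrosses 0 (real (Suc h)) 1 (\<lambda>t. M t \<omega>)"
        using limit_event_if_upcrosses[OF elim(5) A elim(2)] by blast
      then have "\<forall>t\<ge>0. M t \<omega> \<le> real (Suc h)"
        using eventually_upcrosses_if_exceeds[OF elim(3,4), of "real (Suc h)"]
        by (meson not_less of_nat_0_less_iff zero_less_Suc)
      then show "\<exists>h. \<forall>t\<ge>0. M t \<omega> \<le> h" by blast
    qed
  qed
qed

text \<open>Countably many null sets are united, over integer bounds for \<open>A\<close> and
  rational levels. The upper bound on \<open>M\<close> is kept in the conclusion because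
  \<open>A2\<close> will be bounded by means of it.\<close>

lemma AE_converges_bounded_above:
  "AE \<omega> in P. (\<exists>k. \<forall>t\<ge>0. A t \<omega> \<le> k) \<longrightarrow> (\<exists>c. ((\<lambda>t. M t \<omega>) \<longlongrightarrow> c) at_top) \<and> (\<exists>h. \<forall>t\<ge>0. M t \<omega> \<le> h)"
proof -
  have "AE \<omega> in P. \<forall>k::nat. \<forall>a b :: rat. a < b \<longrightarrow> (\<forall>t\<ge>0. A t \<omega> < real (Suc k)) \<longrightarrow>
     \<not> ((\<exists>\<^sub>F t in at_top. M t \<omega> < of_rat a) \<and> (\<exists>\<^sub>F t in at_top. of_rat b < M t \<omega>))"
    unfolding AE_all_countable
  proof (intro allI)
    fix k :: nat and a b :: rat
    show "AE \<omega> in P. a < b \<longrightarrow> (\<forall>t\<ge>0. A t \<omega> < real (Suc k)) \<longrightarrow>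
     \<not> ((\<exists>\<^sub>F t in at_top. M t \<omega> < of_rat a) \<and> (\<exists>\<^sub>F t in at_top. of_rat b < M t \<omega>))"
    proof (cases "a < b")
      case True
      then show ?thesis
        using AE_not_oscillating[of "of_rat a" "of_rat b" "real (Suc k)"] by (simp add: of_rat_less)
    qed simp
  qed
  moreover have "AE \<omega> in P. \<forall>k::nat. (\<forall>t\<ge>0. A t \<omega> < real (Suc k)) \<longrightarrow> (\<exists>h. \<forall>t\<ge>0. M t \<omega> \<le> h)"
    unfolding AE_all_countable by (intro allI AE_bounded_above) simp
  ultimately show ?thesis
    using nonneg
  proof eventually_elim
    case (elim \<omega>)
    show ?case
    proof
      assume "\<exists>k. \<forall>t\<ge>0. A t \<omega> \<le> k"
      then obtain k0 where "\<forall>t\<ge>0. A t \<omega> \<le> k0" ..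
      moreover obtain k :: nat where "k0 \<le> real k"
        using real_arch_simple by blast
      ultimately have k: "\<forall>t\<ge>0. A t \<omega> < real (Suc k)"
        by fastforce
      obtain h where h: "\<forall>t\<ge>0. M t \<omega> \<le> h"
        using elim(2) k by blast
      have "- Z0 \<omega> - real (Suc k) \<le> M t \<omega>" if "0 \<le> t" for t
        using elim(3) k that by (smt (verit))
      then have "\<exists>c. ((\<lambda>t. M t \<omega>) \<longlongrightarrow> c) at_top"
        using h elim(1) k
        by (intro converges_if_bounded_not_oscillating[where l = "- Z0 \<omega> - real (Suc k)" and h = h]) blast+
      then show "(\<exists>c. ((\<lambda>t. M t \<omega>) \<longlongrightarrow> c) at_top) \<and> (\<exists>h. \<forall>t\<ge>0. M t \<omega> \<le> h)"
        using h by blast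
    qed
  qed
qed

end

section \<open>Passage to the capacity\<close>

lemma nondecreasing_bounded_converges:
  fixes f :: "real \<Rightarrow> real"
  assumes f: "nondecreasing_from_0 f" and ub: "\<And>t. 0 \<le> t \<Longrightarrow> f t \<le> h"
  shows "\<exists>c. (f \<longlongrightarrow> c) at_top"
proof -
  have bdd: "bdd_above (f ` {0..})"
    using ub by (auto simp: bdd_above_def)
  have "(f \<longlongrightarrow> (SUP t\<in>{0..}. f t)) at_top"
  proof (rule order_tendstoI)
    fix y assume "y < (SUP t\<in>{0..}. f t)"
    then obtain s where s: "0 \<le> s" "y < f s"
      using less_cSUP_iff[OF _ bdd] by auto
    show "\<forall>\<^sub>F t in at_top. y < f t"
      using eventually_ge_at_top[of s]
    proof eventually_elim
      case (elim t)
      then have "f s \<le> f t"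
        using nondecreasing_from_0_le[OF f s(1)] by simp
      then show ?case using s(2) by simp
    qed
  next
    fix y assume y: "(SUP t\<in>{0..}. f t) < y"
    show "\<forall>\<^sub>F t in at_top. f t < y"
      using eventually_ge_at_top[of 0]
    proof eventually_elim
      case (elim t)
      then have "f t \<le> (SUP t\<in>{0..}. f t)"
        by (intro cSUP_upper[OF _ bdd]) auto
      then show ?case using y by simp
    qed
  qed
  then show ?thesis ..
qed

lemma at_infinity_value_less_top_if_bounded:
  assumes "nondecreasing_from_0 (\<lambda>t. X t \<omega>)" "\<And>t. 0 \<le> t \<Longrightarrow> X t \<omega> \<le> h"
  shows "at_infinity_value X \<omega> < \<infinity>"
proof -
  obtain c where "((\<lambda>t. X t \<omega>) \<longlongrightarrow> c) at_top"
    using nondecreasing_bounded_converges[OF assms] by blast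
  then have "((\<lambda>t. ereal (X t \<omega>)) \<longlongrightarrow> ereal c) at_top"
    by simp
  then show ?thesis
    unfolding at_infinity_value_def by (subst tendsto_Lim) auto
qed

text \<open>\<open>Lim\<close> is meaningful only when a limit exists. An unbounded nondecreasing
  path does have one in the extended reals, namely infinity.\<close>

lemma bounded_if_at_infinity_value_less_top:
  assumes X: "nondecreasing_from_0 (\<lambda>t. X t \<omega>)" and fin: "at_infinity_value X \<omega> < \<infinity>"
  shows "\<exists>h. \<forall>t\<ge>0. X t \<omega> \<le> h"
proof (rule ccontr)
  assume unbdd: "\<not> ?thesis"
  have "((\<lambda>t. ereal (X t \<omega>)) \<longlongrightarrow> \<infinity>) at_top"
    unfolding tendsto_PInfty
  proof
    fix r
    obtain s where s: "0 \<le> s" "r < X s \<omega>"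
      using unbdd by (meson not_less)
    show "\<forall>\<^sub>F t in at_top. ereal r < ereal (X t \<omega>)"
      using eventually_ge_at_top[of s]
    proof eventually_elim
      case (elim t)
      then have "X s \<omega> \<le> X t \<omega>"
        using nondecreasing_from_0_le[OF X s(1)] by simp
      then show ?case using s(2) by simp
    qed
  qed
  then have "at_infinity_value X \<omega> = \<infinity>"
    unfolding at_infinity_value_def by (intro tendsto_Lim) auto
  then show False using fin by simp
qed

section \<open>Polar sets and null sets of the representing measures\<close>

lemma quasi_surely_AE:
  assumes Q: "Q \<in> rep_measures G" and "quasi_surely G p"
  shows "AE \<omega> in completion Q. p \<omega>"
proof -
  obtain N where N: "N \<in> polar_sets G" "\<And>\<omega>. \<omega> \<in> path_space - N \<Longrightarrow> p \<omega>"
    using assms(2) by (auto simp: quasi_surely_def)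
  have sp: "space Q = path_space"
    using Q by (simp add: rep_measures_def)
  have "outer_measure_of Q N \<le> capacity G N"
    unfolding capacity_def using Q by (rule SUP_upper)
  then have "outer_measure_of Q N = 0"
    using N(1) by (simp add: polar_sets_def)
  moreover have "N \<subseteq> space Q"
    using N(1) sp by (simp add: polar_sets_def)
  \<comment> \<open>The outer measure of \<open>N\<close> is attained by a Borel superset, which is
    therefore a null set.\<close>
  ultimately obtain E where "E \<in> null_sets Q" "N \<subseteq> E"
    using outer_measure_of_attain[of N Q] by (auto intro: null_setsI)
  then have "AE \<omega> in Q. p \<omega>"
    using N(2) sp by (intro AE_I'[of E]) auto
  then show ?thesis
    by (rule AE_completion)
qed

text \<open>The capacity is a supremum of outer measures, so the representing measures can be
  treated one at a time.\<close>

lemma capacity_eq_0_if_AE: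
  assumes "A \<subseteq> path_space" and "\<And>Q. Q \<in> rep_measures G \<Longrightarrow> AE \<omega> in completion Q. \<omega> \<notin> A"
  shows "capacity G A = 0"
proof -
  have "outer_measure_of Q A = 0" if Q: "Q \<in> rep_measures G" for Q
  proof -
    have "AE \<omega> in Q. \<omega> \<notin> A"
      using assms(2)[OF Q] by (simp add: AE_completion_iff)
    then obtain E where "{\<omega> \<in> space Q. \<not> \<omega> \<notin> A} \<subseteq> E" "emeasure Q E = 0" "E \<in> sets Q"
      by (rule AE_E)
    moreover have "A \<subseteq> space Q"
      using assms(1) Q by (simp add: rep_measures_def)
    ultimately have "outer_measure_of Q A \<le> outer_measure_of Q E"
      by (intro outer_measure_of_mono) auto
    then show ?thesis
      using \<open>emeasure Q E = 0\<close> \<open>E \<in> sets Q\<close> by simp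
  qed
  then have "capacity G A \<le> 0"
    unfolding capacity_def by (intro SUP_least) auto
  then show ?thesis by simp
qed

lemma subalgebra_\<F>_mono:
  fixes G :: "real^'a^'a \<Rightarrow> real"
  assumes "s \<le> t"
  shows "subalgebra (\<F> G t) (\<F> G s :: 'a::finite path measure)"
proof -
  define C :: "real \<Rightarrow> 'a path set set" where
    "C t = {canonical s -` S \<inter> path_space | s S. s \<in> {0..t} \<and> S \<in> sets borel} \<union> polar_sets G" for t
  have F: "\<F> G t = sigma path_space (C t)" for t
    by (simp add: \<F>_def polar_completion_def C_def)
  have sub: "C t \<subseteq> Pow path_space" for t
    by (auto simp: C_def polar_sets_def)
  have "C s \<subseteq> C t"
    unfolding C_def using assms by fastforce
  then show ?thesis
    unfolding subalgebra_def F
    by (simp add: space_measure_of[OF sub] sets_measure_of[OF sub] sigma_sets_mono')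
qed

theorem mainTheorem4:
  fixes G :: "real^'m^'m \<Rightarrow> real"
    and A1 A2 Z M :: "real \<Rightarrow> 'm::finite path \<Rightarrow> real"
    and \<tau> :: "nat \<Rightarrow> 'm path \<Rightarrow> ennreal"
  assumes "sublinear_on_sym G" and "monotone_on_sym G"
    and "is_process G A1" and "is_process G A2" and "is_process G Z" and "is_process G M"
    and "quasi_surely G (\<lambda>\<omega>. nondecreasing_from_0 (\<lambda>t. A1 t \<omega>))"
    and "quasi_surely G (\<lambda>\<omega>. nondecreasing_from_0 (\<lambda>t. A2 t \<omega>))"
    and "adapted G A1"
    and "quasi_surely G (\<lambda>\<omega>. continuous_on {0..} (\<lambda>t. A1 t \<omega>))"
    and "adapted G Z"
    and "quasi_surely G (\<lambda>\<omega>. \<forall>t\<ge>0. 0 \<le> Z t \<omega>)"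
    and "G_expectation_nn G (\<lambda>\<omega>. ennreal \<bar>Z 0 \<omega>\<bar>) < \<infinity>"
    and "quasi_surely G (\<lambda>\<omega>. \<forall>t\<ge>0. Z t \<omega> = Z 0 \<omega> + A1 t \<omega> - A2 t \<omega> + M t \<omega>)"
    and "quasi_surely G (\<lambda>\<omega>. M 0 \<omega> = 0)"
    and "quasi_surely G (\<lambda>\<omega>. continuous_on {0..} (\<lambda>t. M t \<omega>))"
    and "\<And>N. is_stopping_time G (\<tau> N)"
    and "quasi_surely G (\<lambda>\<omega>. (\<lambda>N. \<tau> N \<omega>) \<longlonglongrightarrow> \<infinity>)"
    and "\<And>Q N t. Q \<in> rep_measures G \<Longrightarrow> 0 \<le> t \<Longrightarrow>
           integrable (completion Q) (stopped M (\<tau> N) t)"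
    and "\<And>Q N s t. Q \<in> rep_measures G \<Longrightarrow> 0 \<le> s \<Longrightarrow> s \<le> t \<Longrightarrow>
           AE \<omega> in completion Q.
             real_cond_exp (completion Q) (\<F> G s) (stopped M (\<tau> N) t) \<omega> = stopped M (\<tau> N) s \<omega>"
  shows "capacity G
    ({\<omega> \<in> path_space. at_infinity_value A1 \<omega> < \<infinity>} -
     ({\<omega> \<in> path_space. has_finite_limit Z \<omega>} \<inter>
      {\<omega> \<in> path_space. at_infinity_value A2 \<omega> < \<infinity>} \<inter>
      {\<omega> \<in> path_space. has_finite_limit M \<omega>})) = 0"
proof (rule capacity_eq_0_if_AE)
  fix Q :: "'m path measure" assume Q: "Q \<in> rep_measures G"
  note qs = quasi_surely_AE[OF Q]
  \<comment> \<open>The filtration contains polar sets, which need not be Borel, so it is a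
    subalgebra of the completion.\<close>
  have sub: "subalgebra (completion Q) (\<F> G t)" for t
    using Q by (rule subalgebra_\<F>)
  interpret Q: prob_space Q
    using Q by (simp add: rep_measures_def)
  have integrable_Z0: "integrable (completion Q) (Z 0)"
  proof (rule integrableI_bounded)
    show "Z 0 \<in> borel_measurable (completion Q)"
      using assms(11) measurable_from_subalg[OF sub] by (auto simp: adapted_def)
    \<comment> \<open>The G-expectation is a supremum of integrals over all representing measures,
      one of which is \<open>Q\<close>.\<close>
    have "(\<integral>\<^sup>+\<omega>. ennreal (norm (Z 0 \<omega>)) \<partial>completion Q) \<le> G_expectation_nn G (\<lambda>\<omega>. ennreal \<bar>Z 0 \<omega>\<bar>)"
      unfolding G_expectation_nn_def using Q by (intro SUP_upper2[of Q]) auto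
    then show "(\<integral>\<^sup>+\<omega>. ennreal (norm (Z 0 \<omega>)) \<partial>completion Q) < \<infinity>"
      using assms(13) by (rule le_less_trans)
  qed
  have nonneg: "AE \<omega> in completion Q. \<forall>t\<ge>0. 0 \<le> Z 0 \<omega> + A1 t \<omega> + M t \<omega>"
    using qs[OF assms(8)] qs[OF assms(12)] qs[OF assms(14)]
  proof eventually_elim
    case (elim \<omega>)
    show ?case
    proof (intro allI impI)
      fix t :: real assume "0 \<le> t"
      then have "A2 0 \<omega> \<le> A2 t \<omega>" "A2 0 \<omega> = 0"
        using nondecreasing_from_0_le[OF elim(1), of 0 t] elim(1)
        by (simp_all add: nondecreasing_from_0_def)
      then show "0 \<le> Z 0 \<omega> + A1 t \<omega> + M t \<omega>"
        using elim(2,3) \<open>0 \<le> t\<close> by (smt (verit))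
    qed
  qed
  interpret stopped_martingale "completion Q" "\<F> G" A1 M "Z 0" \<tau>
  proof (intro stopped_martingale.intro stopped_martingale_axioms.intro)
    show "prob_space (completion Q)"
      by (rule Q.prob_space_completion)
    show "A1 t \<in> borel_measurable (\<F> G t)" if "0 \<le> t" for t
      using assms(9) that by (simp add: adapted_def)
    show "{\<omega> \<in> space (completion Q). \<tau> N \<omega> \<le> ennreal t} \<in> sets (completion Q)" if "0 \<le> t" for N t
      using assms(17)[of N] that sub[of t] Q
      by (auto simp: is_stopping_time_def subalgebra_def rep_measures_def)
  qed (use sub subalgebra_\<F>_mono qs assms integrable_Z0 nonneg Q in auto)
  show "AE \<omega> in completion Q. \<omega> \<notin>
    {\<omega> \<in> path_space. at_infinity_value A1 \<omega> < \<infinity>} -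
     ({\<omega> \<in> path_space. has_finite_limit Z \<omega>} \<inter>
      {\<omega> \<in> path_space. at_infinity_value A2 \<omega> < \<infinity>} \<inter>
      {\<omega> \<in> path_space. has_finite_limit M \<omega>})"
    using AE_converges_bounded_above qs[OF assms(7)] qs[OF assms(8)] qs[OF assms(12)] qs[OF assms(14)]
  proof eventually_elim
    case (elim \<omega>)
    have "has_finite_limit Z \<omega> \<and> at_infinity_value A2 \<omega> < \<infinity> \<and> has_finite_limit M \<omega>"
      if fin: "at_infinity_value A1 \<omega> < \<infinity>"
    proof -
      note Z = elim(5)[rule_format]
      obtain k where k: "\<And>t. 0 \<le> t \<Longrightarrow> A1 t \<omega> \<le> k"
        using bounded_if_at_infinity_value_less_top[of A1 \<omega>, OF elim(2) fin] by blast
      then obtain m where m: "((\<lambda>t. M t \<omega>) \<longlongrightarrow> m) at_top"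
        using elim(1) by blast
      obtain h where h: "\<And>t. 0 \<le> t \<Longrightarrow> M t \<omega> \<le> h"
        using elim(1) k by blast
      \<comment> \<open>Solve the decomposition for \<open>A2\<close> and drop \<open>Z\<close>,
        which is non-negative.\<close>
      have A2: "A2 t \<omega> \<le> Z 0 \<omega> + k + h" if "0 \<le> t" for t
        using Z[OF that] elim(4) that k[OF that] h[OF that] by (smt (verit))
      obtain c1 where c1: "((\<lambda>t. A1 t \<omega>) \<longlongrightarrow> c1) at_top"
        using nondecreasing_bounded_converges[OF elim(2) k] by blast
      obtain c2 where c2: "((\<lambda>t. A2 t \<omega>) \<longlongrightarrow> c2) at_top"
        using nondecreasing_bounded_converges[OF elim(3) A2] by blast
      have "((\<lambda>t. Z 0 \<omega> + A1 t \<omega> - A2 t \<omega> + M t \<omega>) \<longlongrightarrow> Z 0 \<omega> + c1 - c2 + m) at_top"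
        by (intro tendsto_intros c1 c2 m)
      moreover have "\<forall>\<^sub>F t in at_top. Z 0 \<omega> + A1 t \<omega> - A2 t \<omega> + M t \<omega> = Z t \<omega>"
        using eventually_ge_at_top[of 0] by eventually_elim (simp add: Z[symmetric])
      ultimately have "((\<lambda>t. Z t \<omega>) \<longlongrightarrow> Z 0 \<omega> + c1 - c2 + m) at_top"
        using tendsto_cong by fast
      then show ?thesis
        using m at_infinity_value_less_top_if_bounded[of A2 \<omega>, OF elim(3) A2]
        by (auto simp: has_finite_limit_def)
    qed
    then show ?case by blast
  qed
qed blast

end
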